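(* Let $(\Omega,\mathcal{C},\Lambda)$ be a naive convex co-compact triple and let $A\le\Lambda$ be an Abelian subgroup. Then $$\mathrm{Min}_{\mathcal{C}}(A):=\mathcal{C}\cap\bigcap_{a\in A}\mathrm{Min}(a)$$ is non-empty, and the centralizer $C_\Lambda(A)=\{g\in\Lambda: ga=ag\ \forall a\in A\}$ acts co-compactly on $\mathrm{ConvHull}_\Omega(\mathrm{Min}_{\mathcal{C}}(A))$.
   Context: A properly convex domain $\Omega\subset\mathbb{P}(\mathbb{R}^d)$ is an open subset contained as a bounded convex set in some affine chart; $\mathrm{Aut}(\Omega)=\{g\in\mathrm{PGL}_d(\mathbb{R}):g\Omega=\Omega\}$. Hilbert metric: for distinct $x,y\in\Omega$, let $a,b$ be the points where the projective line through $x,y$ meets $\partial\Omega$, ordered $a,x,y,b$; $H_\Omega(x,y)=\frac12\log\frac{|x-b||y-a|}{|x-a||y-b|}$ (computed in an affine chart), $H_\Omega(x,x)=0$. For $g\in\mathrm{Aut}(\Omega)$, $\tau_\Omega(g)=\inf_{x\in\Omega}H_\Omega(x,gx)$ and $\mathrm{Min}(g)=\{x\in\Omega: H_\Omega(x,gx)=\tau_\Omega(g)\}$. A naive convex co-compact triple $(\Omega,\mathcal{C},\Lambda)$: $\Omega$ a properly convex domain, $\Lambda\le\mathrm{Aut}(\Omega)$ an infinite discrete subgroup, $\mathcal{C}\subset\Omega$ non-empty, closed in $\Omega$, convex, $\Lambda$-invariant with $\Lambda\backslash\mathcal{C}$ compact. For $X\subset\overline{\Omega}$, $\mathrm{ConvHull}_\Omega(X)$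 is the smallest convex subset of $\overline{\Omega}$ containing $X$. Co-compact action on $X$: there is a compact $K\subset X$ with $G\cdot K=X$. *)

theory Defs
  imports "HOL-Analysis.Analysis"
begin

definition proj_space :: "(real^'n) set set" where
  "proj_space = {span {v} | v. v \<noteq> 0}"

definition cone_of :: "(real^'n) set set \<Rightarrow> (real^'n) set" where
  "cone_of X = {v. v \<noteq> 0 \<and> span {v} \<in> X}"

definition lift :: "real^'n \<Rightarrow> (real^'n) set set \<Rightarrow> (real^'n) set" where
  "lift w X = {v. w \<bullet> v = 1 \<and> span {v} \<in> X}"

text \<open>Closure in P(R^d) (quotient topology).\<close>
definition pclosure :: "(real^'n) set set \<Rightarrow> (real^'n) set set" where
  "pclosure X = {span {v} | v. v \<noteq> 0 \<and> v \<in> closure (cone_of X)}"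

text \<open>Compactness in P(R^d) (quotient of the unit sphere).\<close>
definition pcompact :: "(real^'n) set set \<Rightarrow> bool" where
  "pcompact K \<longleftrightarrow> K \<subseteq> proj_space \<and> compact {v. norm v = 1 \<and> span {v} \<in> K}"

definition proper_chart :: "real^'n \<Rightarrow> (real^'n) set set \<Rightarrow> bool" where
  "proper_chart w \<Omega> \<longleftrightarrow> \<Omega> \<noteq> {} \<and> \<Omega> \<subseteq> proj_space \<and> open (cone_of \<Omega>)
     \<and> (\<forall>L\<in>\<Omega>. \<forall>v\<in>L. v \<noteq> 0 \<longrightarrow> w \<bullet> v \<noteq> 0)
     \<and> bounded (lift w \<Omega>) \<and> convex (lift w \<Omega>)"

definition properly_convex :: "(real^'n) set set \<Rightarrow> bool" where
  "properly_convex \<Omega> \<longleftrightarrow> (\<exists>w. proper_chart w \<Omega>)"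

definition chart :: "(real^'n) set set \<Rightarrow> real^'n" where
  "chart \<Omega> = (SOME w. proper_chart w \<Omega>)"

text \<open>Convex subsets of the closure of \<Omega> (convex in an affine chart containing closure \<Omega>).\<close>
definition pconvex :: "(real^'n) set set \<Rightarrow> (real^'n) set set \<Rightarrow> bool" where
  "pconvex \<Omega> X \<longleftrightarrow> X \<subseteq> pclosure \<Omega> \<and> convex (lift (chart \<Omega>) X)"

definition conv_hull_in :: "(real^'n) set set \<Rightarrow> (real^'n) set set \<Rightarrow> (real^'n) set set" where
  "conv_hull_in \<Omega> X = \<Inter>{Y. X \<subseteq> Y \<and> pconvex \<Omega> Y}"

definition chart_pt :: "real^'n \<Rightarrow> (real^'n) set \<Rightarrow> real^'n" where
  "chart_pt w x = (SOME v. v \<in> x \<and> w \<bullet> v = 1)"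

definition hilbert :: "(real^'n) set set \<Rightarrow> (real^'n) set \<Rightarrow> (real^'n) set \<Rightarrow> real" where
  "hilbert \<Omega> x y =
    (if x = y then 0 else
      (let w = chart \<Omega>; p = chart_pt w x; q = chart_pt w y;
           S = {s::real. p + s *\<^sub>R (q - p) \<in> lift w \<Omega>};
           a = p + Inf S *\<^sub>R (q - p); b = p + Sup S *\<^sub>R (q - p)
       in ln ((norm (p - b) * norm (q - a)) / (norm (p - a) * norm (q - b))) / 2))"

definition pcls :: "real^'n^'n \<Rightarrow> (real^'n^'n) set" where
  "pcls g = {c *\<^sub>R g | c. c \<noteq> 0}"

definition PGL :: "(real^'n^'n) set set" where
  "PGL = {pcls g | g. invertible g}"

definition pmul :: "(real^'n^'n) set \<Rightarrow> (real^'n^'n) set \<Rightarrow> (real^'n^'n) set" where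
  "pmul G H = {g ** h | g h. g \<in> G \<and> h \<in> H}"

definition pinv :: "(real^'n^'n) set \<Rightarrow> (real^'n^'n) set" where
  "pinv G = matrix_inv ` G"

definition pone :: "(real^'n^'n) set" where
  "pone = pcls (mat 1)"

definition pact :: "(real^'n^'n) set \<Rightarrow> (real^'n) set \<Rightarrow> (real^'n) set" where
  "pact G L = (\<Union>g\<in>G. (\<lambda>v. g *v v) ` L)"

definition pgl_subgroup :: "(real^'n^'n) set set \<Rightarrow> bool" where
  "pgl_subgroup H \<longleftrightarrow> H \<subseteq> PGL \<and> pone \<in> H \<and> (\<forall>G\<in>H. \<forall>G'\<in>H. pmul G G' \<in> H)
     \<and> (\<forall>G\<in>H. pinv G \<in> H)"

definition discrete_pgl :: "(real^'n^'n) set set \<Rightarrow> bool" where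
  "discrete_pgl H \<longleftrightarrow> (\<exists>e>0. \<forall>G\<in>H. \<forall>g\<in>G. \<bar>det g\<bar> = 1 \<and> dist g (mat 1) < e \<longrightarrow> G = pone)"

definition Aut :: "(real^'n) set set \<Rightarrow> (real^'n^'n) set set" where
  "Aut \<Omega> = {G \<in> PGL. pact G ` \<Omega> = \<Omega>}"

definition transl_len :: "(real^'n) set set \<Rightarrow> (real^'n^'n) set \<Rightarrow> real" where
  "transl_len \<Omega> G = Inf ((\<lambda>x. hilbert \<Omega> x (pact G x)) ` \<Omega>)"

definition Min_set :: "(real^'n) set set \<Rightarrow> (real^'n^'n) set \<Rightarrow> (real^'n) set set" where
  "Min_set \<Omega> G = {x \<in> \<Omega>. hilbert \<Omega> x (pact G x) = transl_len \<Omega> G}"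

definition cocompact :: "(real^'n^'n) set set \<Rightarrow> (real^'n) set set \<Rightarrow> bool" where
  "cocompact H X \<longleftrightarrow> (\<exists>K. K \<subseteq> X \<and> pcompact K \<and> (\<Union>G\<in>H. pact G ` K) = X)"

definition naive_cc :: "(real^'n) set set \<Rightarrow> (real^'n) set set \<Rightarrow> (real^'n^'n) set set \<Rightarrow> bool" where
  "naive_cc \<Omega> C \<Lambda> \<longleftrightarrow> properly_convex \<Omega> \<and> pgl_subgroup \<Lambda> \<and> \<Lambda> \<subseteq> Aut \<Omega> \<and> infinite \<Lambda>
     \<and> discrete_pgl \<Lambda> \<and> C \<noteq> {} \<and> C \<subseteq> \<Omega> \<and> \<Omega> \<inter> pclosure C = C \<and> pconvex \<Omega> C
     \<and> cocompact \<Lambda> C"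

definition centralizer :: "(real^'n^'n) set set \<Rightarrow> (real^'n^'n) set set \<Rightarrow> (real^'n^'n) set set" where
  "centralizer \<Lambda> A = {G \<in> \<Lambda>. \<forall>a\<in>A. pmul G a = pmul a G}"

end

theory Submission
  imports Defs
begin

text \<open>Lift \<open>\<Omega>\<close> to an open cone \<open>K\<close> and order the vector space by \<open>closure K\<close>. For a linear map \<open>a\<close>
  preserving \<open>K\<close> let \<open>cw a\<close> be its Collatz--Wielandt number, the infimum of all \<open>\<mu> > 0\<close> with
  \<open>a x \<preceq> \<mu> x\<close> for some \<open>x \<in> K\<close>. The Hilbert metric is half the logarithm of a product of two
  order gauges, so the displacement of \<open>a\<close> at \<open>x\<close> is at least \<open>ln (cw a * cw (a\<inverse>)) / 2\<close>, with
  equality iff \<open>a x \<preceq> cw a x\<close> and \<open>a\<inverse> x \<preceq> cw (a\<inverse>) x\<close>. This condition is linear in \<open>x\<close>; once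
  it is attained, \<open>Min a\<close> is therefore convex and the convex hull in the theorem is the minimal set
  itself.

  Truncated Neumann series of the resolvents produce, in the cone over \<open>C\<close>, common approximate
  solutions for finitely many commuting maps. By discreteness the centralizer of \<open>A\<close> acts
  cocompactly on the points of \<open>C\<close> of bounded displacement under a finite subset of \<open>A\<close> with the
  same linear span, so the approximate solutions can be moved into one compact set, where the finite
  intersection property yields an exact solution.\<close>

section \<open>Ordered cones and Collatz--Wielandt numbers\<close>

text \<open>\<open>norm_K\<close> bounds the slice of the cone on which \<open>w\<close> equals 1.
  The bound passes to \<open>closure K\<close>, so \<open>closure K\<close> contains no line and the
  preorder \<open>\<preceq>\<close> defined below is in fact antisymmetric.\<close>

locale proper_cone =
  fixes K :: "'a::euclidean_space set" and w :: 'a and R :: real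
  assumes open_K: "open K"
    and K_ne: "K \<noteq> {}"
    and add_K: "\<And>u v. u \<in> K \<Longrightarrow> v \<in> K \<Longrightarrow> u + v \<in> K"
    and scale_K: "\<And>c v. c > 0 \<Longrightarrow> v \<in> K \<Longrightarrow> c *\<^sub>R v \<in> K"
    and pos_K: "\<And>v. v \<in> K \<Longrightarrow> w \<bullet> v > 0"
    and norm_K: "\<And>v. v \<in> K \<Longrightarrow> norm v \<le> R * (w \<bullet> v)"
begin

definition le :: "'a \<Rightarrow> 'a \<Rightarrow> bool" (infix "\<preceq>" 50)
  where "u \<preceq> v \<longleftrightarrow> v - u \<in> closure K"

section \<open>Arithmetic of the closed cone\<close>

lemma add_closure: "u \<in> closure K \<Longrightarrow> v \<in> closure K \<Longrightarrow> u + v \<in> closure K"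
proof -
  assume u: "u \<in> closure K" and v: "v \<in> closure K"
  obtain x where x: "\<And>n. x n \<in> K" "x \<longlonglongrightarrow> u" using u by (auto simp: closure_sequential)
  obtain y where y: "\<And>n. y n \<in> K" "y \<longlonglongrightarrow> v" using v by (auto simp: closure_sequential)
  have "(\<lambda>n. x n + y n) \<longlonglongrightarrow> u + v" using x y by (intro tendsto_add)
  moreover have "\<forall>n. x n + y n \<in> K" using x(1) y(1) add_K by simp
  ultimately show ?thesis unfolding closure_sequential by (intro exI[of _ "\<lambda>n. x n + y n"] conjI)
qed

lemma scale_closure_pos: "c > 0 \<Longrightarrow> v \<in> closure K \<Longrightarrow> c *\<^sub>R v \<in> closure K"
proof -
  assume c: "c > 0" and v: "v \<in> closure K"
  obtain y where y: "\<And>n. y n \<in> K" "y \<longlonglongrightarrow> v" using v by (auto simp: closure_sequential)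
  have "(\<lambda>n. c *\<^sub>R y n) \<longlonglongrightarrow> c *\<^sub>R v" using y by (intro tendsto_intros)
  moreover have "\<forall>n. c *\<^sub>R y n \<in> K" using y(1) c scale_K by simp
  ultimately show ?thesis unfolding closure_sequential by (intro exI[of _ "\<lambda>n. c *\<^sub>R y n"] conjI)
qed

lemma zero_closure: "0 \<in> closure K"
proof -
  obtain v where v: "v \<in> K" using K_ne by blast
  have "(\<lambda>n. inverse (real (Suc n)) *\<^sub>R v) \<longlonglongrightarrow> 0 *\<^sub>R v"
    by (intro tendsto_intros LIMSEQ_inverse_real_of_nat)
  moreover have "inverse (real (Suc n)) *\<^sub>R v \<in> K" for n using v by (intro scale_K) auto
  ultimately show ?thesis unfolding closure_sequential by fastforce
qed

lemma scale_closure: "c \<ge> 0 \<Longrightarrow> v \<in> closure K \<Longrightarrow> c *\<^sub>R v \<in> closure K"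
  using scale_closure_pos[of c v] zero_closure by (cases "c = 0") auto

lemma in_closure: "v \<in> K \<Longrightarrow> v \<in> closure K"
  using closure_subset by blast

lemma sum_closure: "(\<And>i. i \<in> I \<Longrightarrow> f i \<in> closure K) \<Longrightarrow> sum f I \<in> closure K"
  by (induction I rule: infinite_finite_induct) (auto simp: zero_closure add_closure)

lemma norm_closure: "v \<in> closure K \<Longrightarrow> norm v \<le> R * (w \<bullet> v)"
  proof -
  assume v: "v \<in> closure K"
  have "closed {x. norm x \<le> R * (w \<bullet> x)}" by (intro closed_Collect_le continuous_intros)
  then have "closure K \<subseteq> {x. norm x \<le> R * (w \<bullet> x)}" using norm_K by (intro closure_minimal) auto
  then show ?thesis using v by blast
qed

lemma R_pos: "R > 0"
proof -
  obtain v where v: "v \<in> K" using K_ne by blast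
  have "v \<noteq> 0" using pos_K[OF v] by auto
  then have "0 < R * (w \<bullet> v)" using norm_K[OF v] by (smt (verit) norm_le_zero_iff)
  then show ?thesis using pos_K[OF v] by (simp add: zero_less_mult_iff)
qed

lemma inner_closure_nonneg: "v \<in> closure K \<Longrightarrow> w \<bullet> v \<ge> 0"
  using norm_closure[of v] R_pos norm_ge_zero[of v] zero_le_mult_iff[of R "w \<bullet> v"] by linarith

section \<open>The order given by the closed cone and its order units\<close>

lemma le_refl: "u \<preceq> u"
  by (simp add: le_def zero_closure)

lemma le_trans: "u \<preceq> v \<Longrightarrow> v \<preceq> z \<Longrightarrow> u \<preceq> z"
  using add_closure[of "v - u" "z - v"] by (simp add: le_def)

lemma le_add: "u \<preceq> v \<Longrightarrow> u' \<preceq> v' \<Longrightarrow> u + u' \<preceq> v + v'"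
  using add_closure[of "v - u" "v' - u'"] by (simp add: le_def algebra_simps)

lemma le_scale: "c \<ge> 0 \<Longrightarrow> u \<preceq> v \<Longrightarrow> c *\<^sub>R u \<preceq> c *\<^sub>R v"
  using scale_closure[of c "v - u"] by (simp add: le_def algebra_simps)

lemma le_scale_mono: "c \<le> d \<Longrightarrow> v \<in> closure K \<Longrightarrow> c *\<^sub>R v \<preceq> d *\<^sub>R v"
  using scale_closure[of "d - c" v] by (simp add: le_def algebra_simps)

lemma le_scale_iff: "c > 0 \<Longrightarrow> c *\<^sub>R u \<preceq> c *\<^sub>R v \<longleftrightarrow> u \<preceq> v"
  using le_scale[of c u v] le_scale[of "inverse c" "c *\<^sub>R u" "c *\<^sub>R v"] by auto

lemma le_scale_imp_pos:
  assumes "u \<in> K" "v \<in> K" "u \<preceq> c *\<^sub>R v" shows "c > 0"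
proof -
  have "w \<bullet> (c *\<^sub>R v - u) \<ge> 0" using assms(3) inner_closure_nonneg le_def by blast
  then have "c * (w \<bullet> v) > 0" using pos_K[OF assms(1)] by (simp add: inner_diff_right)
  then show ?thesis using pos_K[OF assms(2)] by (simp add: zero_less_mult_iff)
qed

text \<open>By compactness one radius \<open>e\<close> keeps all balls around points of
  \<open>Q\<close> inside the open cone. Then \<open>q - e v\<close> lies in \<open>K\<close>, and
  dividing by \<open>e\<close> gives the constant \<open>1 / e\<close> for all \<open>q\<close> at
  once. This uniformity later bounds whole families of matrices.\<close>

lemma uniform_order_unit:
  assumes "compact Q" "Q \<subseteq> K"
  obtains c where "c > 0" "\<And>q v. q \<in> Q \<Longrightarrow> norm v \<le> 1 \<Longrightarrow> v \<preceq> c *\<^sub>R q"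
proof -
  obtain e where e: "e > 0" "(\<Union>x\<in>Q. cball x e) \<subseteq> K"
    using compact_subset_open_imp_cball_epsilon_subset[OF assms(1) open_K assms(2)] by metis
  have "v \<preceq> inverse e *\<^sub>R q" if q: "q \<in> Q" and v: "norm v \<le> 1" for q v
  proof -
    have "q - e *\<^sub>R v \<in> cball q e" using v e(1) by (auto simp: dist_norm)
    then have "q - e *\<^sub>R v \<in> K" using e(2) q by blast
    then have "inverse e *\<^sub>R (q - e *\<^sub>R v) \<in> closure K" using e(1) in_closure scale_K by simp
    then show ?thesis using e(1) by (simp add: le_def algebra_simps)
  qed
  then show ?thesis using that[of "inverse e"] e(1) by simp
qed

lemma order_unit:
  assumes "x \<in> K" obtains c where "c > 0" "v \<preceq> c *\<^sub>R x"
proof -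
  obtain c where c: "c > 0" "\<And>q v. q \<in> {x} \<Longrightarrow> norm v \<le> 1 \<Longrightarrow> v \<preceq> c *\<^sub>R q"
    using uniform_order_unit[of "{x}"] assms by auto
  let ?n = "norm v + 1"
  have n: "?n > 0" by (simp add: add_nonneg_pos)
  have "norm (inverse ?n *\<^sub>R v) \<le> 1" using n by (simp add: field_simps)
  then have "inverse ?n *\<^sub>R v \<preceq> c *\<^sub>R x" using c(2) by blast
  then have "v \<preceq> (?n * c) *\<^sub>R x" using le_scale[of ?n "inverse ?n *\<^sub>R v" "c *\<^sub>R x"] n by simp
  moreover have "?n * c > 0" using c(1) n by simp
  ultimately show ?thesis using that by blast
qed

section \<open>Cone maps and Collatz-Wielandt numbers\<close>

definition cone_map :: "('a \<Rightarrow> 'a) \<Rightarrow> bool"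
  where "cone_map f \<longleftrightarrow> linear f \<and> f ` K \<subseteq> K"

lemma cone_map_le: "cone_map f \<Longrightarrow> u \<preceq> v \<Longrightarrow> f u \<preceq> f v"
  using closure_linear_image_subset[of f K] closure_mono[of "f ` K" K]
  unfolding le_def cone_map_def by (metis imageI linear_diff subset_iff)

lemma cone_map_pow: "cone_map f \<Longrightarrow> cone_map (f ^^ n)"
  by (induction n) (auto simp: cone_map_def linear_id[unfolded id_def] linear_iff image_subset_iff)

text \<open>The vector \<open>x\<close> ranges over the open cone only, so the infimum need not be
  attained; parabolic automorphisms of the hyperbolic disc show this. Attainment inside the cone
  over \<open>C\<close> is the real issue of the proof.\<close>

definition cw :: "('a \<Rightarrow> 'a) \<Rightarrow> real"
  where "cw f = Inf {\<mu>. \<mu> > 0 \<and> (\<exists>x\<in>K. f x \<preceq> \<mu> *\<^sub>R x)}"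

lemma cw_le: "x \<in> K \<Longrightarrow> \<mu> > 0 \<Longrightarrow> f x \<preceq> \<mu> *\<^sub>R x \<Longrightarrow> cw f \<le> \<mu>"
  unfolding cw_def by (rule cInf_lower) (auto intro!: bdd_belowI[of _ 0])

lemma cw_less:
  assumes "cw f < \<mu>"
  obtains \<nu> x where "0 < \<nu>" "\<nu> < \<mu>" "x \<in> K" "f x \<preceq> \<nu> *\<^sub>R x"
proof -
  obtain x where x: "x \<in> K" using K_ne by blast
  obtain c where "c > 0" "f x \<preceq> c *\<^sub>R x" using order_unit[OF x] by metis
  then have "{\<mu>. \<mu> > 0 \<and> (\<exists>x\<in>K. f x \<preceq> \<mu> *\<^sub>R x)} \<noteq> {}" using x by blast
  from cInf_lessD[OF this assms[unfolded cw_def]] show ?thesis using that by blast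
qed

lemma cw_nonneg: "cw f \<ge> 0"
proof (rule ccontr)
  assume "\<not> cw f \<ge> 0"
  then have "cw f < 0" by simp
  then show False using cw_less[of f 0] by (metis less_asym)
qed

lemma pow_le:
  assumes f: "cone_map f" and "\<mu> \<ge> 0" "f x \<preceq> \<mu> *\<^sub>R x"
  shows "(f ^^ n) x \<preceq> \<mu> ^ n *\<^sub>R x"
proof (induction n)
  case (Suc n)
  have "(f ^^ Suc n) x \<preceq> f (\<mu> ^ n *\<^sub>R x)" using cone_map_le[OF f Suc] by simp
  also have "f (\<mu> ^ n *\<^sub>R x) = \<mu> ^ n *\<^sub>R f x" using f by (simp add: cone_map_def linear_cmul)
  finally show ?case using le_scale[of "\<mu> ^ n" "f x" "\<mu> *\<^sub>R x"] assms le_trans by (simp add: mult.commute)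
qed (simp add: le_refl)

text \<open>Any two points of \<open>K\<close> dominate each other up to factors \<open>c\<close>
  and \<open>d\<close>. Hence a subeigenvector \<open>y\<close> with value
  \<open>\<nu> < \<mu>\<close> limits the growth at every \<open>x\<close> to
  \<open>c d \<nu>^n\<close>, and for a large exponent \<open>\<mu>^n\<close> absorbs
  \<open>c d\<close>. The exponent has the form \<open>Suc N\<close> because this is the term left
  over when a sum over \<open>n \<le> N\<close> telescopes.\<close>

lemma pow_eventually_le:
  assumes f: "cone_map f" and "cw f < \<mu>" and x: "x \<in> K"
  obtains N where "(f ^^ Suc N) x \<preceq> \<mu> ^ Suc N *\<^sub>R x"
proof -
  obtain \<nu> y where y: "0 < \<nu>" "\<nu> < \<mu>" "y \<in> K" "f y \<preceq> \<nu> *\<^sub>R y" using cw_less assms(2) by metis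
  obtain c where c: "c > 0" "x \<preceq> c *\<^sub>R y" using order_unit[OF y(3)] by metis
  obtain d where d: "d > 0" "y \<preceq> d *\<^sub>R x" using order_unit[OF x] by metis
  have "\<nu> / \<mu> < 1" "0 < \<nu> / \<mu>" using y by auto
  then obtain N where N: "(\<nu> / \<mu>) ^ N < 1 / (c * d)"
    using real_arch_pow_inv[of "1 / (c * d)" "\<nu> / \<mu>"] c d by auto
  have "(\<nu> / \<mu>) ^ Suc N \<le> (\<nu> / \<mu>) ^ N"
    using \<open>\<nu> / \<mu> < 1\<close> \<open>0 < \<nu> / \<mu>\<close> by (intro power_decreasing) auto
  then have "(\<nu> / \<mu>) ^ Suc N \<le> 1 / (c * d)" using N by linarith
  then have le: "c * \<nu> ^ Suc N * d \<le> \<mu> ^ Suc N"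
    using c d y by (simp add: power_divide field_simps)
  let ?F = "f ^^ Suc N"
  have F: "cone_map ?F" using cone_map_pow[OF f] .
  have "?F x \<preceq> ?F (c *\<^sub>R y)" using cone_map_le[OF F c(2)] .
  moreover have "?F (c *\<^sub>R y) = c *\<^sub>R ?F y" using F unfolding cone_map_def by (metis linear_cmul)
  moreover have "c *\<^sub>R ?F y \<preceq> c *\<^sub>R (\<nu> ^ Suc N *\<^sub>R y)"
    using pow_le[OF f _ y(4)] y(1) c(1) le_scale by (meson less_imp_le)
  moreover have "(c * \<nu> ^ Suc N) *\<^sub>R y \<preceq> (c * \<nu> ^ Suc N) *\<^sub>R (d *\<^sub>R x)"
    using d(2) c(1) y(1) by (intro le_scale) auto
  moreover have "(c * \<nu> ^ Suc N * d) *\<^sub>R x \<preceq> \<mu> ^ Suc N *\<^sub>R x"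
    using le x in_closure by (intro le_scale_mono) auto
  ultimately have "?F x \<preceq> \<mu> ^ Suc N *\<^sub>R x" using le_trans by (metis scaleR_scaleR)
  then show ?thesis using that by blast
qed

text \<open>A truncated Neumann series \<open>\<Sum>n\<le>N. \<mu>\<^sup>-\<^sup>n f\<^sup>n x\<close> of the resolvent improves \<open>x\<close> to a
  \<open>\<mu>\<close>-subeigenvector of \<open>f\<close>; maps commuting with \<open>f\<close> keep their own inequalities.\<close>

lemma common_subeigenvector:
  assumes "finite F"
    and "\<And>f \<mu>. (f, \<mu>) \<in> F \<Longrightarrow> cone_map f \<and> f ` D \<subseteq> D \<and> cw f < \<mu>"
    and "\<And>f \<mu> g \<nu>. (f, \<mu>) \<in> F \<Longrightarrow> (g, \<nu>) \<in> F \<Longrightarrow> f \<circ> g = g \<circ> f"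
    and D: "D \<noteq> {}" "D \<subseteq> K" "\<And>u v. u \<in> D \<Longrightarrow> v \<in> D \<Longrightarrow> u + v \<in> D"
      "\<And>c v. c > 0 \<Longrightarrow> v \<in> D \<Longrightarrow> c *\<^sub>R v \<in> D"
  shows "\<exists>x\<in>D. \<forall>(f, \<mu>)\<in>F. f x \<preceq> \<mu> *\<^sub>R x"
  using assms(1-3)
proof (induction F rule: finite_induct)
  case empty
  then show ?case using D(1) by auto
next
  case (insert p F)
  obtain f \<mu> where p: "p = (f, \<mu>)" by force
  have f: "cone_map f" "f ` D \<subseteq> D" "cw f < \<mu>" using insert.prems(1)[of f \<mu>] p by auto
  have lf: "linear f" using f(1) cone_map_def by blast
  have \<mu>: "\<mu> > 0" using f(3) cw_nonneg[of f] by linarith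
  obtain x where x: "x \<in> D" "\<forall>(f, \<mu>)\<in>F. f x \<preceq> \<mu> *\<^sub>R x"
    using insert.IH insert.prems by (metis (no_types, lifting) insert_iff)
  then have xK: "x \<in> K" using D(2) by blast
  obtain N where N: "(f ^^ Suc N) x \<preceq> \<mu> ^ Suc N *\<^sub>R x"
    using pow_eventually_le[OF f(1) f(3) xK] by blast
  define t where "t n = inverse \<mu> ^ n *\<^sub>R (f ^^ n) x" for n
  define z where "z = (\<Sum>n\<le>N. t n)"
  have fn: "(f ^^ n) x \<in> D" for n using x(1) f(2) by (induction n) auto
  have tD: "t n \<in> D" for n using fn \<mu> D(4) by (simp add: t_def)
  have zD: "z \<in> D" unfolding z_def
  proof (induction N)
    case (Suc n)
    then show ?case using D(3)[OF Suc tD] by simp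
  qed (simp add: tD)
  \<comment> \<open>Applying \<open>f\<close> shifts the series by one index at the price of the
    factor \<open>\<mu>\<close>. So \<open>\<mu> z - f z\<close> telescopes to its first and last
    terms, and the choice of \<open>N\<close> places that difference in the closed cone.\<close>
  have ft: "f (t n) = \<mu> *\<^sub>R t (Suc n)" for n using lf \<mu> by (simp add: t_def linear_cmul)
  have "f z = (\<Sum>n\<le>N. \<mu> *\<^sub>R t (Suc n))" unfolding z_def using lf by (simp add: linear_sum ft)
  also have "\<dots> = \<mu> *\<^sub>R (\<Sum>n\<le>N. t (Suc n))" by (simp add: scaleR_right.sum)
  finally have "\<mu> *\<^sub>R z - f z = \<mu> *\<^sub>R ((\<Sum>n\<le>N. t n) - (\<Sum>n\<le>N. t (Suc n)))" by (simp add: z_def algebra_simps)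
  also have "(\<Sum>n\<le>N. t n) - (\<Sum>n\<le>N. t (Suc n)) = t 0 - t (Suc N)"
    using sum_telescope[of t N] by (simp add: sum_subtractf)
  also have "\<mu> *\<^sub>R (t 0 - t (Suc N)) = (\<mu> * inverse \<mu> ^ Suc N) *\<^sub>R (\<mu> ^ Suc N *\<^sub>R x - (f ^^ Suc N) x)"
    using \<mu> by (simp add: t_def algebra_simps power_inverse)
  finally have "f z \<preceq> \<mu> *\<^sub>R z"
    using N \<mu> scale_closure[of "\<mu> * inverse \<mu> ^ Suc N"] by (simp add: le_def del: funpow.simps power_Suc)
  moreover have "g z \<preceq> \<nu> *\<^sub>R z" if g: "(g, \<nu>) \<in> F" for g \<nu>
  proof -
    have lg: "linear g" using insert.prems(1)[of g \<nu>] g cone_map_def by auto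
    have com: "g \<circ> f = f \<circ> g" by (rule insert.prems(2)) (use g p in auto)
    have gf: "g ((f ^^ n) x) = (f ^^ n) (g x)" for n
      by (induction n) (simp_all add: fun_cong[OF com, unfolded o_def])
    \<comment> \<open>Because \<open>g\<close> commutes with \<open>f\<close>, the defect of
      \<open>t n\<close> is a positive multiple of the image under \<open>f ^^ n\<close> of the
      defect of \<open>x\<close>, and this image stays in the closed cone.\<close>
    have "\<nu> *\<^sub>R t n - g (t n) = inverse \<mu> ^ n *\<^sub>R (f ^^ n) (\<nu> *\<^sub>R x - g x)" for n
      using cone_map_pow[OF f(1), of n] lg
      by (simp add: t_def gf cone_map_def linear_diff linear_cmul algebra_simps)
    moreover have "(f ^^ n) (\<nu> *\<^sub>R x - g x) \<in> closure K" for n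
      using cone_map_le[OF cone_map_pow[OF f(1), of n], of "g x" "\<nu> *\<^sub>R x"] x(2) g
        cone_map_pow[OF f(1), of n] unfolding le_def cone_map_def
      by (metis (no_types, lifting) case_prodD linear_diff)
    ultimately have "\<nu> *\<^sub>R t n - g (t n) \<in> closure K" for n using \<mu> scale_closure by simp
    then have "(\<Sum>n\<le>N. \<nu> *\<^sub>R t n - g (t n)) \<in> closure K" by (rule sum_closure)
    then show ?thesis using lg
      by (simp add: le_def z_def sum_subtractf scaleR_right.sum linear_sum)
  qed
  ultimately show ?case using zD p by auto
qed

end

section \<open>Cocompact groups of cone automorphisms\<close>

lemma matrix_inv_works:
  fixes g :: "real^'n^'n"
  assumes "invertible g"
  shows matrix_inv_right: "g ** matrix_inv g = mat 1" and matrix_inv_left: "matrix_inv g ** g = mat 1"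
  using someI_ex[OF assms[unfolded invertible_def]] by (simp_all add: matrix_inv_def)

lemma matrix_inv_unique:
  fixes g :: "real^'n^'n"
  assumes "g ** h = mat 1" shows "matrix_inv g = h"
proof -
  have "h ** g = mat 1" using assms matrix_left_right_inverse by blast
  then have "invertible g" using assms by (auto simp: invertible_def)
  then have "h = h ** (g ** matrix_inv g)" by (simp add: matrix_inv_right)
  then show ?thesis using \<open>h ** g = mat 1\<close> by (simp add: matrix_mul_assoc)
qed

text \<open>Every entry of \<open>h\<close> is a coordinate of the image of a basis vector, and the
  norm is at most the sum of the absolute values of the entries. Only the independence of the bound
  from \<open>h\<close> matters.\<close>

lemma matrix_norm_le:
  fixes h :: "real^'n^'n"
  assumes "\<And>v. norm v \<le> 1 \<Longrightarrow> norm (h *v v) \<le> B"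
  shows "norm h \<le> (\<Sum>i\<in>(UNIV::'n set). \<Sum>j\<in>(UNIV::'n set). B)"
proof -
  have "\<bar>h $ i $ j\<bar> \<le> B" for i j
  proof -
    have "h $ i $ j = (h *v axis j 1) $ i"
      by (simp add: matrix_vector_mult_basis column_def)
    then have "\<bar>h $ i $ j\<bar> \<le> norm (h *v axis j 1)" using component_le_norm_cart by metis
    also have "\<dots> \<le> B" by (intro assms) simp
    finally show ?thesis .
  qed
  moreover have "norm h \<le> (\<Sum>i\<in>UNIV. norm (h $ i))" unfolding norm_vec_def by (intro L2_set_le_sum) auto
  moreover have "norm (h $ i) \<le> (\<Sum>j\<in>UNIV. \<bar>h $ i $ j\<bar>)" for i by (rule norm_le_l1_cart)
  ultimately show ?thesis by (meson sum_mono order.trans)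
qed

lemma matrix_mult_add_left: "(A + B) ** C = A ** C + B ** C" for A B :: "real^'n^'m" and C :: "real^'k^'n"
  by (simp add: matrix_matrix_mult_def vec_eq_iff sum.distrib algebra_simps)

lemma matrix_mult_scaleR_left: "(c *\<^sub>R A) ** B = c *\<^sub>R (A ** B)" for A :: "real^'n^'m" and B :: "real^'k^'n"
  by (simp add: matrix_matrix_mult_def vec_eq_iff sum_distrib_left algebra_simps)

lemma matrix_mult_scaleR_right: "A ** (c *\<^sub>R B) = c *\<^sub>R (A ** B)" for A :: "real^'n^'m" and B :: "real^'k^'n"
  by (simp add: matrix_matrix_mult_def vec_eq_iff sum_distrib_left algebra_simps)

lemmas matrix_mult_bilinear =
  matrix_add_ldistrib matrix_mult_add_left matrix_mult_scaleR_left matrix_mult_scaleR_right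

lemma matrix_mult_diff_right: "A ** (B - C) = A ** B - A ** C" for A :: "real^'n^'m" and B C :: "real^'k^'n"
  by (simp add: matrix_matrix_mult_def vec_eq_iff sum_subtractf algebra_simps)

lemma bounded_bilinear_matrix_mult:
  "bounded_bilinear ((**) :: real^'n^'n \<Rightarrow> real^'n^'n \<Rightarrow> real^'n^'n)"
  by (simp add: bilinear_conv_bounded_bilinear[symmetric] bilinear_def linear_iff matrix_mult_bilinear)

text \<open>Linear model of the triple: \<open>K\<close> and \<open>D\<close> are the cones over the
  domain and over \<open>C\<close>, \<open>L\<close> consists of matrices representing the group,
  and \<open>Q\<close> meets every \<open>L\<close>-orbit of rays in \<open>D\<close>. The factor
  \<open>c\<close> in \<open>cover\<close> is there because only rays have a projective
  meaning.\<close>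

locale cc_cone = proper_cone K w R for K :: "(real^'n) set" and w R +
  fixes L :: "(real^'n^'n) set" and D Q :: "(real^'n) set"
  assumes one_L: "mat 1 \<in> L"
    and mul_L: "\<And>g h. g \<in> L \<Longrightarrow> h \<in> L \<Longrightarrow> g ** h \<in> L"
    and invertible_L: "\<And>g. g \<in> L \<Longrightarrow> invertible g"
    and inv_L: "\<And>g. g \<in> L \<Longrightarrow> matrix_inv g \<in> L"
    and L_K: "\<And>g v. g \<in> L \<Longrightarrow> v \<in> K \<Longrightarrow> g *v v \<in> K"
    and L_D: "\<And>g v. g \<in> L \<Longrightarrow> v \<in> D \<Longrightarrow> g *v v \<in> D"
    and discrete_L: "\<exists>e>0. \<forall>g\<in>L. dist g (mat 1) < e \<longrightarrow> g = mat 1"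
    and D_K: "D \<subseteq> K" and D_ne: "D \<noteq> {}"
    and D_add: "\<And>u v. u \<in> D \<Longrightarrow> v \<in> D \<Longrightarrow> u + v \<in> D"
    and D_scale: "\<And>c v. c > 0 \<Longrightarrow> v \<in> D \<Longrightarrow> c *\<^sub>R v \<in> D"
    and compact_Q: "compact Q" and Q_D: "Q \<subseteq> D"
    and cover: "\<And>v. v \<in> D \<Longrightarrow> \<exists>g\<in>L. \<exists>q\<in>Q. \<exists>c>0. v = c *\<^sub>R (g *v q)"
begin

section \<open>Bounded displacement and the centralizer\<close>

lemmas inv_right = matrix_inv_right[OF invertible_L]
lemmas inv_left = matrix_inv_left[OF invertible_L]

lemma inv_act: "g \<in> L \<Longrightarrow> matrix_inv g *v (g *v v) = v"
  by (simp add: inv_left matrix_vector_mul_assoc)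

lemma cone_map_L: "g \<in> L \<Longrightarrow> cone_map ((*v) g)"
  using L_K by (auto simp: cone_map_def)

lemma L_le: "g \<in> L \<Longrightarrow> u \<preceq> v \<Longrightarrow> g *v u \<preceq> g *v v"
  using cone_map_le[OF cone_map_L] .

lemma L_le_iff: "g \<in> L \<Longrightarrow> g *v u \<preceq> g *v v \<longleftrightarrow> u \<preceq> v"
  using L_le[of g u v] L_le[OF inv_L, of g "g *v u" "g *v v"] by (auto simp: inv_act)

lemma closed_subeigen: "closed {x. g *v x \<preceq> c *\<^sub>R x}"
proof -
  have "closed ((\<lambda>x. c *\<^sub>R x - g *v x) -` closure K)"
    by (intro closed_vimage closed_closure continuous_intros)
  then show ?thesis by (simp add: le_def vimage_def)
qed

text \<open>For a unit vector \<open>v\<close> both \<open>v\<close> and \<open>- v\<close> lie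
  below \<open>c q\<close>, so both \<open>h v\<close> and \<open>- h v\<close> lie below
  \<open>c \<mu> q\<close>. Order intervals of a proper cone are norm bounded, which bounds
  \<open>h\<close> uniformly.\<close>

lemma bounded_displacement_bounded:
  "bounded {h\<in>L. \<exists>q\<in>Q. h *v q \<preceq> \<mu> *\<^sub>R q}"
proof -
  obtain c where c: "c > 0" "\<And>q v. q \<in> Q \<Longrightarrow> norm v \<le> 1 \<Longrightarrow> v \<preceq> c *\<^sub>R q"
    using uniform_order_unit[OF compact_Q] Q_D D_K by blast
  obtain r where r: "\<And>q. q \<in> Q \<Longrightarrow> norm q \<le> r" using compact_imp_bounded[OF compact_Q] by (auto simp: bounded_iff)
  let ?B = "3 * (R * (norm w * (c * (\<bar>\<mu>\<bar> * r))))"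
  have "norm (h *v v) \<le> ?B"
    if h: "h \<in> L" and q: "q \<in> Q" "h *v q \<preceq> \<mu> *\<^sub>R q" and v: "norm v \<le> 1" for h q v
  proof -
    have "h *v (c *\<^sub>R q) \<preceq> c *\<^sub>R (\<mu> *\<^sub>R q)"
      using le_scale[OF _ q(2), of c] c(1) by (simp add: matrix_vector_mult_scaleR)
    moreover have "h *v v \<preceq> h *v (c *\<^sub>R q)" "h *v (- v) \<preceq> h *v (c *\<^sub>R q)"
      using c(2)[OF q(1), of v] c(2)[OF q(1), of "- v"] v by (auto intro!: L_le[OF h])
    ultimately have *: "h *v v \<preceq> c *\<^sub>R (\<mu> *\<^sub>R q)" "- (h *v v) \<preceq> c *\<^sub>R (\<mu> *\<^sub>R q)"
      using le_trans by (metis scaleR_minus1_left matrix_vector_mult_scaleR)+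
    let ?y = "c *\<^sub>R (\<mu> *\<^sub>R q)"
    have y: "?y - h *v v \<in> closure K" "?y + h *v v \<in> closure K" using * by (simp_all add: le_def)
    have wy: "w \<bullet> ?y \<le> norm w * (c * (\<bar>\<mu>\<bar> * r))"
    proof -
      have "w \<bullet> ?y \<le> norm w * norm ?y" by (rule norm_cauchy_schwarz)
      also have "norm ?y \<le> c * (\<bar>\<mu>\<bar> * r)" using c(1) r[OF q(1)] by (simp add: abs_mult mult_left_mono mult.assoc)
      finally show ?thesis by (simp add: mult_left_mono)
    qed
    have "norm (?y + h *v v) \<le> R * (w \<bullet> (?y + h *v v))" "norm (?y - h *v v) \<le> R * (w \<bullet> (?y - h *v v))"
      using norm_closure y by auto
    \<comment> \<open>When the bounds for \<open>?y + h v\<close> and \<open>?y - h v\<close> are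
      added, the values of \<open>w\<close> on \<open>h v\<close> cancel and only
      \<open>w \<bullet> ?y\<close> remains.\<close>
    moreover have "norm (2 *\<^sub>R (h *v v)) \<le> norm (?y + h *v v) + norm (?y - h *v v)"
      using norm_triangle_ineq4[of "?y + h *v v" "?y - h *v v"] by (simp add: scaleR_2)
    ultimately have "norm (2 *\<^sub>R (h *v v)) \<le> R * (w \<bullet> (?y + h *v v)) + R * (w \<bullet> (?y - h *v v))" by linarith
    also have "\<dots> = 2 * (R * (w \<bullet> ?y))" by (simp add: algebra_simps)
    finally have "norm (h *v v) \<le> R * (w \<bullet> ?y)" by simp
    also have "\<dots> \<le> R * (norm w * (c * (\<bar>\<mu>\<bar> * r)))" using wy R_pos by (simp add: mult_left_mono)
    also have "\<dots> \<le> ?B"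
    proof -
      have "0 \<le> r" using r[OF q(1)] norm_ge_zero order.trans by blast
      then have "0 \<le> R * (norm w * (c * (\<bar>\<mu>\<bar> * r)))" using R_pos c(1) by simp
      then show ?thesis by linarith
    qed
    finally show ?thesis .
  qed
  then have "norm h \<le> (\<Sum>i\<in>(UNIV::'n set). \<Sum>j\<in>(UNIV::'n set). ?B)"
    if "h \<in> L" "q \<in> Q" "h *v q \<preceq> \<mu> *\<^sub>R q" for h q
    using that by (intro matrix_norm_le) blast
  then show ?thesis unfolding bounded_iff by blast
qed

text \<open>The two-sided condition bounds both \<open>h\<close> and its inverse. Two such matrices
  that are close then have a quotient close to the identity, so discreteness at the identity
  separates the whole set uniformly, and a bounded uniformly discrete set is finite.\<close>

lemma bounded_displacement_finite:
  "finite {h\<in>L. \<exists>q\<in>Q. h *v q \<preceq> \<mu> *\<^sub>R q \<and> matrix_inv h *v q \<preceq> \<mu> *\<^sub>R q}" (is "finite ?S")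
proof -
  let ?T = "{h\<in>L. \<exists>q\<in>Q. h *v q \<preceq> \<mu> *\<^sub>R q}"
  have ST: "?S \<subseteq> ?T" "matrix_inv ` ?S \<subseteq> ?T" using inv_L by auto
  then have bS: "bounded ?S" using bounded_displacement_bounded bounded_subset by blast
  obtain B where B: "B > 0" "\<And>h. h \<in> ?T \<Longrightarrow> norm h \<le> B"
    using bounded_displacement_bounded[of \<mu>] by (auto simp: bounded_pos)
  obtain C where C: "C > 0" "\<And>(a :: real^'n^'n) (b :: real^'n^'n). norm (a ** b) \<le> norm a * norm b * C"
    using bounded_bilinear.pos_bounded[OF bounded_bilinear_matrix_mult] by blast
  obtain e where e: "e > 0" "\<And>g. g \<in> L \<Longrightarrow> dist g (mat 1) < e \<Longrightarrow> g = mat 1" using discrete_L by blast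
  \<comment> \<open>The distance \<open>e / (B C)\<close> is what remains of \<open>e\<close> after
    multiplication by an inverse of norm at most \<open>B\<close>, with \<open>C\<close> the norm
    constant of the matrix product.\<close>
  have "h = h'" if h: "h \<in> ?S" "h' \<in> ?S" and d: "dist h h' < e / (B * C)" for h h'
  proof -
    have L: "h \<in> L" "h' \<in> L" using h by auto
    have "matrix_inv h ** h' - mat 1 = matrix_inv h ** (h' - h)"
      using L by (simp add: matrix_mult_diff_right inv_left)
    then have "norm (matrix_inv h ** h' - mat 1) \<le> norm (matrix_inv h) * norm (h' - h) * C" using C(2) by simp
    also have "\<dots> \<le> B * norm (h' - h) * C"
      using B(2)[of "matrix_inv h"] ST(2) h(1) C(1) by (intro mult_right_mono) auto
    also have "\<dots> < e" using d B(1) C(1) by (simp add: dist_norm norm_minus_commute field_simps)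
    finally have "matrix_inv h ** h' = mat 1" using e(2) L mul_L inv_L by (simp add: dist_norm)
    then have "h ** (matrix_inv h ** h') = h" by simp
    then show ?thesis using L by (simp add: matrix_mul_assoc inv_right)
  qed
  then have "uniform_discrete ?S"
    unfolding uniform_discrete_def using e(1) B(1) C(1) by (intro exI[of _ "e / (B * C)"]) auto
  then show ?thesis using bS uniform_discrete_finite_iff by blast
qed

text \<open>If \<open>x = g q\<close> has small displacement under \<open>b\<close>, then so has \<open>q\<close> under \<open>g\<^sup>-\<^sup>1 b g\<close>, which
  leaves finitely many conjugates; two such \<open>g\<close> with the same conjugates differ by an element of
  the centralizer.\<close>

lemma centralizer_cocompact:
  assumes B: "finite B" "B \<subseteq> L"
  obtains Q0 where "compact Q0" "Q0 \<subseteq> D"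
    "\<And>x. x \<in> D \<Longrightarrow> \<forall>b\<in>B. b *v x \<preceq> \<mu> *\<^sub>R x \<and> matrix_inv b *v x \<preceq> \<mu> *\<^sub>R x \<Longrightarrow>
      \<exists>z\<in>L. \<exists>q\<in>Q0. \<exists>c>0. (\<forall>b\<in>B. z ** b = b ** z) \<and> x = c *\<^sub>R (z *v q)"
proof -
  define P where "P x \<longleftrightarrow> (\<forall>b\<in>B. b *v x \<preceq> \<mu> *\<^sub>R x \<and> matrix_inv b *v x \<preceq> \<mu> *\<^sub>R x)" for x
  define X where "X = {g\<in>L. \<exists>q\<in>Q. P (g *v q)}"
  \<comment> \<open>All conjugates are recorded in one extensional function on \<open>B\<close>, so
    that finiteness of the image follows from finiteness of a product over \<open>B\<close>.\<close>
  define \<phi> :: "real^'n^'n \<Rightarrow> _" where "\<phi> g = (\<lambda>b\<in>B. matrix_inv g ** b ** g)" for g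
  let ?S = "{h\<in>L. \<exists>q\<in>Q. h *v q \<preceq> \<mu> *\<^sub>R q \<and> matrix_inv h *v q \<preceq> \<mu> *\<^sub>R q}"
  have conj: "matrix_inv g ** b ** g \<in> ?S" if g: "g \<in> X" and b: "b \<in> B" for g b
  proof -
    obtain q where q: "q \<in> Q" "P (g *v q)" and gL: "g \<in> L" using g X_def by auto
    have bL: "b \<in> L" using b B by auto
    let ?h = "matrix_inv g ** b ** g"
    have hL: "?h \<in> L" using gL bL mul_L inv_L by simp
    \<comment> \<open>The inverse of a conjugate is the conjugate of the inverse, so the bound for
      \<open>matrix_inv b\<close> gives the second half of membership in \<open>?S\<close>.\<close>
    have "?h ** (matrix_inv g ** matrix_inv b ** g) = matrix_inv g ** (b ** (g ** matrix_inv g) ** matrix_inv b) ** g"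
      by (simp add: matrix_mul_assoc)
    then have "?h ** (matrix_inv g ** matrix_inv b ** g) = mat 1" using gL bL by (simp add: inv_right inv_left)
    then have hi: "matrix_inv ?h = matrix_inv g ** matrix_inv b ** g" by (rule matrix_inv_unique)
    have *: "(matrix_inv g ** c ** g) *v q \<preceq> \<mu> *\<^sub>R q" if c: "c *v (g *v q) \<preceq> \<mu> *\<^sub>R (g *v q)" for c
    proof -
      have "g *v ((matrix_inv g ** c ** g) *v q) = ((g ** matrix_inv g) ** c ** g) *v q"
        by (simp add: matrix_mul_assoc matrix_vector_mul_assoc)
      also have "\<dots> = c *v (g *v q)" using gL by (simp add: inv_right matrix_vector_mul_assoc)
      finally have "g *v ((matrix_inv g ** c ** g) *v q) \<preceq> g *v (\<mu> *\<^sub>R q)" using c by (simp add: matrix_vector_mult_scaleR)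
      then show ?thesis using L_le_iff gL by blast
    qed
    show ?thesis using hL q b * unfolding P_def hi[symmetric] by (auto simp: hi)
  qed
  have sub: "\<phi> ` X \<subseteq> PiE B (\<lambda>_. ?S)" using conj by (auto simp: \<phi>_def)
  have "finite (\<phi> ` X)"
    by (rule finite_subset[OF sub]) (intro finite_PiE B(1) bounded_displacement_finite)
  \<comment> \<open>The finite set \<open>G\<close> represents every value of \<open>\<phi>\<close>;
    its translates of \<open>Q\<close> form the compact set sought.\<close>
  then obtain G where G: "finite G" "G \<subseteq> X" "\<phi> ` X = \<phi> ` G" by (metis finite_subset_image subset_refl)
  define Q0 where "Q0 = (\<Union>g\<in>G. (*v) g ` Q)"
  have "compact Q0" unfolding Q0_def
    by (intro compact_UN G(1) compact_continuous_image compact_Q continuous_intros)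
  moreover have "Q0 \<subseteq> D" using G(2) Q_D L_D by (fastforce simp: Q0_def X_def)
  moreover have "\<exists>z\<in>L. \<exists>q\<in>Q0. \<exists>c>0. (\<forall>b\<in>B. z ** b = b ** z) \<and> x = c *\<^sub>R (z *v q)"
    if x: "x \<in> D" "P x" for x
  proof -
    obtain g q c where g: "g \<in> L" "q \<in> Q" "c > 0" "x = c *\<^sub>R (g *v q)" using cover x(1) by blast
    have "b *v (c *\<^sub>R v) \<preceq> \<mu> *\<^sub>R (c *\<^sub>R v) \<longleftrightarrow> b *v v \<preceq> \<mu> *\<^sub>R v" for b v
      using le_scale_iff[OF g(3), of "b *v v" "\<mu> *\<^sub>R v"] by (simp add: matrix_vector_mult_scaleR mult.commute)
    then have "P (g *v q)" using x(2) g(4) by (simp add: P_def)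
    then have "g \<in> X" using g by (auto simp: X_def)
    then obtain g' where g': "g' \<in> G" "\<phi> g = \<phi> g'" using G(3) by blast
    have g'L: "g' \<in> L" using g'(1) G(2) by (auto simp: X_def)
    \<comment> \<open>Equal conjugates under \<open>g\<close> and \<open>g'\<close> mean exactly
      that this quotient commutes with every element of \<open>B\<close>.\<close>
    define z where "z = g ** matrix_inv g'"
    have zL: "z \<in> L" using g g'L mul_L inv_L by (simp add: z_def)
    have "z ** b = b ** z" if b: "b \<in> B" for b
    proof -
      have "matrix_inv g ** b ** g = matrix_inv g' ** b ** g'"
        using fun_cong[OF g'(2), of b] b by (simp add: \<phi>_def)
      then have "g ** (matrix_inv g ** b ** g) ** matrix_inv g' = g ** (matrix_inv g' ** b ** g') ** matrix_inv g'" by simp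
      then have "(g ** matrix_inv g) ** b ** (g ** matrix_inv g') = (g ** matrix_inv g') ** b ** (g' ** matrix_inv g')"
        by (simp only: matrix_mul_assoc)
      then show ?thesis using g(1) g'L by (simp add: z_def inv_right)
    qed
    moreover have "z *v (g' *v q) = g *v q"
      using inv_left[OF g'L] by (simp add: z_def matrix_vector_mul_assoc flip: matrix_mul_assoc)
    moreover have "g' *v q \<in> Q0" using g' g by (auto simp: Q0_def)
    ultimately show ?thesis using zL g(3,4) by metis
  qed
  ultimately show ?thesis using that unfolding P_def by blast
qed

text \<open>The condition is one-sided, but it will be applied to sets closed under inverses, where
  it covers both halves of the equality case of the displacement. It is linear in \<open>x\<close>,
  which is the source of convexity.\<close>

definition Min_cone :: "(real^'n^'n) set \<Rightarrow> (real^'n) set" where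
  "Min_cone A = {x\<in>D. \<forall>a\<in>A. a *v x \<preceq> cw ((*v) a) *\<^sub>R x}"

lemma Min_cone_cocompact:
  assumes A: "A \<subseteq> L" "\<And>a. a \<in> A \<Longrightarrow> matrix_inv a \<in> A" "\<And>a b. a \<in> A \<Longrightarrow> b \<in> A \<Longrightarrow> a ** b = b ** a"
  shows "Min_cone A \<noteq> {}"
    and "\<exists>Q'. compact Q' \<and> Q' \<subseteq> Min_cone A \<and>
      (\<forall>x\<in>Min_cone A. \<exists>z\<in>L. \<exists>q\<in>Q'. \<exists>c>0. (\<forall>a\<in>A. z ** a = a ** z) \<and> x = c *\<^sub>R (z *v q))"
proof -
  let ?cw = "\<lambda>a. cw ((*v) a)"
  \<comment> \<open>\<open>A\<close> may be infinite, while a basis of its linear span is finite.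
    Commuting with \<open>z\<close> is a linear condition on a matrix, so centralizing
    \<open>B\<close> already means centralizing \<open>A\<close>.\<close>
  obtain B where B: "B \<subseteq> A" "independent B" "A \<subseteq> span B" using basis_exists[of A] by metis
  have fB: "finite B" using B(2) finiteI_independent by blast
  have BL: "B \<subseteq> L" using B A by blast
  have centr: "\<forall>a\<in>A. z ** a = a ** z" if z: "\<forall>b\<in>B. z ** b = b ** z" for z
  proof
    fix a assume "a \<in> A"
    then have "a \<in> span B" using B by blast
    then show "z ** a = a ** z"
    proof (induction a rule: span_induct_alt)
      case base then show ?case by simp
    next
      case (step c x y)
      then show ?case using z by (simp add: matrix_mult_bilinear)
    qed
  qed
  \<comment> \<open>One number strictly above the Collatz-Wielandt numbers of all basis elements and
    of their inverses; all summands are nonnegative.\<close>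
  define \<mu> where "\<mu> = 1 + (\<Sum>b\<in>B. ?cw b + ?cw (matrix_inv b))"
  have \<mu>: "?cw b < \<mu> \<and> ?cw (matrix_inv b) < \<mu>" if "b \<in> B" for b
  proof -
    have "?cw b + ?cw (matrix_inv b) \<le> (\<Sum>b\<in>B. ?cw b + ?cw (matrix_inv b))"
      using that fB cw_nonneg by (intro member_le_sum) auto
    then show ?thesis using cw_nonneg[of "(*v) b"] cw_nonneg[of "(*v) (matrix_inv b)"] by (simp add: \<mu>_def)
  qed
  obtain Q0 where Q0: "compact Q0" "Q0 \<subseteq> D"
    "\<And>x. x \<in> D \<Longrightarrow> \<forall>b\<in>B. b *v x \<preceq> \<mu> *\<^sub>R x \<and> matrix_inv b *v x \<preceq> \<mu> *\<^sub>R x \<Longrightarrow>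
      \<exists>z\<in>L. \<exists>q\<in>Q0. \<exists>c>0. (\<forall>b\<in>B. z ** b = b ** z) \<and> x = c *\<^sub>R (z *v q)"
    using centralizer_cocompact[OF fB BL, of \<mu>] by metis
  \<comment> \<open>A matrix \<open>z\<close> that commutes with \<open>a\<close> transports
    subeigenvectors of \<open>a\<close> with the same value, so \<open>z\<close> and the scalar can
    be cancelled.\<close>
  have pull: "a *v q \<preceq> \<nu> *\<^sub>R q"
    if "z \<in> L" "c > 0" "z ** a = a ** z" "a *v (c *\<^sub>R (z *v q)) \<preceq> \<nu> *\<^sub>R (c *\<^sub>R (z *v q))" for z c a q \<nu>
  proof -
    have "a *v (c *\<^sub>R (z *v q)) = c *\<^sub>R (z *v (a *v q))"
      using that(3) by (simp add: matrix_vector_mult_scaleR matrix_vector_mul_assoc)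
    moreover have "\<nu> *\<^sub>R (c *\<^sub>R (z *v q)) = c *\<^sub>R (z *v (\<nu> *\<^sub>R q))" by (simp add: matrix_vector_mult_scaleR)
    ultimately show ?thesis using that le_scale_iff L_le_iff by metis
  qed
  define E where "E p = {x. fst p *v x \<preceq> snd p *\<^sub>R x}" for p :: "(real^'n^'n) \<times> real"
  \<comment> \<open>These are the approximate conditions, each with a value strictly above
    \<open>?cw a\<close>. Any finite number of them is solvable, and together they amount to the
    exact conditions.\<close>
  define I where "I = {(a, \<nu>). a \<in> A \<and> ?cw a < \<nu>}"
  have "Q0 \<inter> (\<Inter>p\<in>I. E p) \<noteq> {}"
  proof (rule compact_imp_fip_image)
    show "compact Q0" by fact
    show "closed (E p)" for p using closed_subeigen[of "fst p" "snd p"] by (simp add: E_def)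
    fix J assume J: "finite J" "J \<subseteq> I"
    \<comment> \<open>Adding the bounds \<open>\<mu>\<close> for \<open>B\<close> and its inverses
      forces the common solution to have bounded displacement, so a centralizing element moves it
      into \<open>Q0\<close>.\<close>
    let ?J = "J \<union> (\<lambda>b. (b, \<mu>)) ` B \<union> (\<lambda>b. (matrix_inv b, \<mu>)) ` B"
    have "(\<lambda>b. (b, \<mu>)) ` B \<subseteq> I" "(\<lambda>b. (matrix_inv b, \<mu>)) ` B \<subseteq> I"
      using \<mu> B(1) A(2) by (auto simp: I_def)
    then have JI: "?J \<subseteq> I" using J(2) by blast
    have com: "(*v) a \<circ> (*v) b = (*v) b \<circ> (*v) a" if "a \<in> A" "b \<in> A" for a b
      using A(3)[OF that] by (auto simp: fun_eq_iff matrix_vector_mul_assoc)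
    have "\<exists>x\<in>D. \<forall>(f, \<nu>)\<in>(\<lambda>(a, \<nu>). ((*v) a, \<nu>)) ` ?J. f x \<preceq> \<nu> *\<^sub>R x"
    proof (rule common_subeigenvector)
      show "finite ((\<lambda>(a, \<nu>). ((*v) a, \<nu>)) ` ?J)" using J(1) fB by blast
      fix f \<nu> assume "(f, \<nu>) \<in> (\<lambda>(a, \<nu>). ((*v) a, \<nu>)) ` ?J"
      then obtain a where a: "f = (*v) a" "(a, \<nu>) \<in> ?J" by auto
      then have "(a, \<nu>) \<in> I" using JI by blast
      then have aI: "a \<in> A" "?cw a < \<nu>" by (auto simp: I_def)
      then show "cone_map f \<and> f ` D \<subseteq> D \<and> cw f < \<nu>" using a(1) A(1) cone_map_L L_D by blast
      fix g \<nu>' assume "(g, \<nu>') \<in> (\<lambda>(a, \<nu>). ((*v) a, \<nu>)) ` ?J"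
      then obtain b where b: "g = (*v) b" "(b, \<nu>') \<in> ?J" by auto
      then have "(b, \<nu>') \<in> I" using JI by blast
      then have "b \<in> A" by (auto simp: I_def)
      then show "f \<circ> g = g \<circ> f" using com aI(1) a(1) b(1) by simp
    qed (use D_ne D_K D_add D_scale in auto)
    then obtain x where x: "x \<in> D" "\<And>a \<nu>. (a, \<nu>) \<in> ?J \<Longrightarrow> a *v x \<preceq> \<nu> *\<^sub>R x" by fastforce
    then have "\<forall>b\<in>B. b *v x \<preceq> \<mu> *\<^sub>R x \<and> matrix_inv b *v x \<preceq> \<mu> *\<^sub>R x" by blast
    from Q0(3)[OF x(1) this] obtain z q c where z: "z \<in> L" "q \<in> Q0" "c > 0" "\<forall>b\<in>B. z ** b = b ** z"
      "x = c *\<^sub>R (z *v q)" by blast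
    have "q \<in> E p" if p: "p \<in> J" for p
    proof -
      have "fst p \<in> A" using p J(2) by (auto simp: I_def)
      moreover have "fst p *v x \<preceq> snd p *\<^sub>R x" using x(2)[of "fst p" "snd p"] p by simp
      ultimately show ?thesis using pull[OF z(1,3)] centr[OF z(4)] z(5) by (simp add: E_def)
    qed
    then show "Q0 \<inter> (\<Inter>p\<in>J. E p) \<noteq> {}" using z(2) by blast
  qed
  then obtain y where y: "y \<in> Q0" "\<And>p. p \<in> I \<Longrightarrow> y \<in> E p" by blast
  have "a *v y \<preceq> ?cw a *\<^sub>R y" if a: "a \<in> A" for a
  proof -
    \<comment> \<open>The conditions with values \<open>?cw a + 1 / (n + 1)\<close> pass to the
      limit because the cone is closed.\<close>
    let ?f = "\<lambda>n. (?cw a + inverse (real (Suc n))) *\<^sub>R y - a *v y"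
    have "?f n \<in> closure K" for n
      using y(2)[of "(a, ?cw a + inverse (real (Suc n)))"] a by (simp add: I_def E_def le_def)
    moreover have "?f \<longlonglongrightarrow> (?cw a + 0) *\<^sub>R y - a *v y"
      by (intro tendsto_intros LIMSEQ_inverse_real_of_nat)
    ultimately show ?thesis unfolding le_def by (metis (no_types, lifting) add_0_right closed_closure closed_sequentially)
  qed
  then have "y \<in> Min_cone A" using y(1) Q0(2) by (auto simp: Min_cone_def)
  then show "Min_cone A \<noteq> {}" by blast
  have Meq: "Q0 \<inter> Min_cone A = Q0 \<inter> (\<Inter>a\<in>A. {x. a *v x \<preceq> ?cw a *\<^sub>R x})"
    using Q0(2) by (auto simp: Min_cone_def)
  have "compact (Q0 \<inter> Min_cone A)" unfolding Meq
    by (intro compact_Int_closed Q0(1) closed_INT ballI closed_subeigen)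
  moreover have "\<exists>z\<in>L. \<exists>q\<in>Q0 \<inter> Min_cone A. \<exists>c>0. (\<forall>a\<in>A. z ** a = a ** z) \<and> x = c *\<^sub>R (z *v q)"
    if x: "x \<in> Min_cone A" for x
  proof -
    have xD: "x \<in> D" and xA: "\<And>a. a \<in> A \<Longrightarrow> a *v x \<preceq> ?cw a *\<^sub>R x" using x by (auto simp: Min_cone_def)
    \<comment> \<open>An exact solution satisfies the bounds \<open>\<mu>\<close> as well, so it is
      a centralizer translate of a point of \<open>Q0\<close>, and by \<open>pull\<close> that point
      is again an exact solution.\<close>
    have "a *v x \<preceq> \<mu> *\<^sub>R x" if "a \<in> A" "?cw a < \<mu>" for a
    proof (rule le_trans[OF xA[OF that(1)]])
      show "?cw a *\<^sub>R x \<preceq> \<mu> *\<^sub>R x" using that(2) xD D_K in_closure by (intro le_scale_mono) auto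
    qed
    then have "\<forall>b\<in>B. b *v x \<preceq> \<mu> *\<^sub>R x \<and> matrix_inv b *v x \<preceq> \<mu> *\<^sub>R x" using \<mu> B(1) A(2) by blast
    from Q0(3)[OF xD this] obtain z q c where z: "z \<in> L" "q \<in> Q0" "c > 0" "\<forall>b\<in>B. z ** b = b ** z"
      "x = c *\<^sub>R (z *v q)" by blast
    have "a *v q \<preceq> ?cw a *\<^sub>R q" if "a \<in> A" for a
      using pull[OF z(1,3)] centr[OF z(4)] z(5) xA that by blast
    then have "q \<in> Q0 \<inter> Min_cone A" using z(2) Q0(2) by (auto simp: Min_cone_def)
    then show ?thesis using z(1,3,5) centr[OF z(4)] by blast
  qed
  ultimately show "\<exists>Q'. compact Q' \<and> Q' \<subseteq> Min_cone A \<and>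
      (\<forall>x\<in>Min_cone A. \<exists>z\<in>L. \<exists>q\<in>Q'. \<exists>c>0. (\<forall>a\<in>A. z ** a = a ** z) \<and> x = c *\<^sub>R (z *v q))"
    by blast
qed

end

section \<open>The Hilbert metric in terms of the cone order\<close>

context proper_cone
begin

text \<open>Replace \<open>y\<close> by a nearby \<open>z\<close> in \<open>K\<close> and charge the
  error to \<open>x\<close>, which has room since \<open>K\<close> is open.\<close>

lemma add_K_closure:
  assumes "x \<in> K" "y \<in> closure K" shows "x + y \<in> K"
proof -
  obtain e where e: "e > 0" "ball x e \<subseteq> K" using assms(1) open_K by (meson openE)
  obtain z where z: "z \<in> K" "dist z y < e" using assms(2) e(1) closure_approachable by blast
  have "x + y - z \<in> ball x e" using z(2) by (simp add: dist_norm norm_minus_commute)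
  then have "(x + y - z) + z \<in> K" using e(2) z(1) by (intro add_K) auto
  then show ?thesis by simp
qed

text \<open>This is Birkhoff's quantity M(u/v); the Hilbert metric is half the logarithm of M(p/q)
  M(q/p).\<close>

definition gauge :: "'a \<Rightarrow> 'a \<Rightarrow> real" where
  "gauge u v = Inf {t. u \<preceq> t *\<^sub>R v}"

lemma gauge_eqI: "u \<preceq> s *\<^sub>R v \<Longrightarrow> (\<And>t. u \<preceq> t *\<^sub>R v \<Longrightarrow> s \<le> t) \<Longrightarrow> gauge u v = s"
  unfolding gauge_def by (rule cInf_eq_minimum) auto

context
  fixes u v assumes u: "u \<in> K" and v: "v \<in> K"
begin

lemma gauge_lower: "u \<preceq> t *\<^sub>R v \<Longrightarrow> gauge u v \<le> t"
  unfolding gauge_def using le_scale_imp_pos[OF u v]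
  by (intro cInf_lower) (auto intro!: bdd_belowI[of _ 0] less_imp_le)

lemma le_gauge: "u \<preceq> gauge u v *\<^sub>R v"
proof -
  have "closed ((\<lambda>t. t *\<^sub>R v - u) -` closure K)"
    by (intro closed_vimage closed_closure continuous_intros)
  then have "closed {t. u \<preceq> t *\<^sub>R v}" by (simp add: le_def vimage_def)
  moreover have "{t. u \<preceq> t *\<^sub>R v} \<noteq> {}" using order_unit[OF v, of u] by blast
  moreover have "bdd_below {t. u \<preceq> t *\<^sub>R v}"
    using le_scale_imp_pos[OF u v] by (auto intro!: bdd_belowI[of _ 0] less_imp_le)
  ultimately have "gauge u v \<in> {t. u \<preceq> t *\<^sub>R v}" unfolding gauge_def by (intro closed_contains_Inf)
  then show ?thesis by simp
qed

lemma gauge_pos: "gauge u v > 0"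
  using le_scale_imp_pos[OF u v le_gauge] .

lemma gauge_scale:
  assumes "c > 0" "d > 0"
  shows "gauge (c *\<^sub>R u) (d *\<^sub>R v) = c / d * gauge u v"
proof (rule gauge_eqI)
  have iff: "c *\<^sub>R u \<preceq> t *\<^sub>R (d *\<^sub>R v) \<longleftrightarrow> u \<preceq> (t * d / c) *\<^sub>R v" for t
    using le_scale_iff[of c u "(t * d / c) *\<^sub>R v"] assms by simp
  show "c *\<^sub>R u \<preceq> (c / d * gauge u v) *\<^sub>R (d *\<^sub>R v)"
    unfolding iff using le_gauge assms by simp
  fix t assume "c *\<^sub>R u \<preceq> t *\<^sub>R (d *\<^sub>R v)"
  then have "gauge u v \<le> t * d / c" using gauge_lower iff by blast
  then show "c / d * gauge u v \<le> t" using assms by (simp add: field_simps)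
qed

end

lemma gauge_self: "u \<in> K \<Longrightarrow> gauge u u = 1"
proof (rule gauge_eqI)
  fix t assume u: "u \<in> K" and "u \<preceq> t *\<^sub>R u"
  then have "0 \<le> w \<bullet> (t *\<^sub>R u - u)" using inner_closure_nonneg le_def by blast
  then have "0 \<le> (t - 1) * (w \<bullet> u)" by (simp add: inner_diff_right algebra_simps)
  then show "1 \<le> t" using pos_K[OF u] by (simp add: zero_le_mult_iff)
qed (simp add: le_refl)

text \<open>The line from \<open>p\<close> through \<open>q\<close> leaves the cone at the parameter
  \<open>Sup S\<close>. The exit point is \<open>Sup S\<close> times \<open>q\<close> minus
  \<open>Sup S - 1\<close> times \<open>p\<close>; being on the boundary, it expresses the sharp
  inequality between \<open>p\<close> and a multiple of \<open>q\<close>.\<close>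

lemma gauge_line:
  fixes p q
  defines "S \<equiv> {s::real. p + s *\<^sub>R (q - p) \<in> K}"
  assumes p: "p \<in> K" "w \<bullet> p = 1" and q: "q \<in> K" "w \<bullet> q = 1" and "p \<noteq> q"
  shows "bdd_above S" "1 < Sup S" "gauge p q = Sup S / (Sup S - 1)"
proof -
  let ?\<gamma> = "\<lambda>s::real. p + s *\<^sub>R (q - p)"
  have w\<gamma>: "w \<bullet> ?\<gamma> s = 1" for s using p q by (simp add: inner_add_right inner_diff_right)
  show bdd: "bdd_above S"
  proof (rule bdd_aboveI)
    fix s assume "s \<in> S"
    then have "norm (?\<gamma> s) \<le> R" using norm_K[of "?\<gamma> s"] w\<gamma> by (simp add: S_def)
    then have "norm (s *\<^sub>R (q - p)) \<le> R + norm p" using norm_triangle_ineq4[of "?\<gamma> s" p] by simp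
    then have "s * norm (q - p) \<le> R + norm p" by (smt (verit) abs_ge_self mult_right_mono norm_ge_zero norm_scaleR)
    then show "s \<le> (R + norm p) / norm (q - p)" using \<open>p \<noteq> q\<close> by (simp add: pos_le_divide_eq)
  qed
  have "open (?\<gamma> -` K)" by (intro open_vimage open_K continuous_intros)
  then have "open S" by (simp add: S_def vimage_def)
  moreover have "1 \<in> S" using q by (simp add: S_def)
  ultimately obtain e where e: "e > 0" "ball 1 e \<subseteq> S" by (meson openE)
  have "1 + e / 2 \<in> ball 1 e" using e(1) by (simp add: dist_real_def)
  then have "1 + e / 2 \<in> S" using e(2) by blast
  then show \<beta>: "1 < Sup S" using cSup_upper[OF _ bdd] e(1) by fastforce
  show "gauge p q = Sup S / (Sup S - 1)"
  proof (rule gauge_eqI)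
    have "Sup S \<in> closure S" using bdd \<open>1 \<in> S\<close> by (intro closure_contains_Sup) auto
    moreover have "closure S \<subseteq> ?\<gamma> -` closure K"
      by (intro closure_minimal closed_vimage closed_closure continuous_intros) (auto simp: S_def in_closure)
    ultimately have "inverse (Sup S - 1) *\<^sub>R ?\<gamma> (Sup S) \<in> closure K" using \<beta> by (intro scale_closure) auto
    moreover have "inverse (Sup S - 1) *\<^sub>R ?\<gamma> (Sup S) = (Sup S / (Sup S - 1)) *\<^sub>R q - p"
    proof -
      have e: "?\<gamma> (Sup S) = Sup S *\<^sub>R q - (Sup S - 1) *\<^sub>R p" by (simp add: algebra_simps)
      show ?thesis unfolding e using \<beta> by (simp add: scaleR_diff_right divide_inverse mult.commute)
    qed
    ultimately show "p \<preceq> (Sup S / (Sup S - 1)) *\<^sub>R q" by (simp add: le_def)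
    fix t assume t: "p \<preceq> t *\<^sub>R q"
    have "0 \<le> w \<bullet> (t *\<^sub>R q - p)" using t inner_closure_nonneg le_def by blast
    then have "t \<ge> 1" using p q by (simp add: inner_diff_right)
    \<comment> \<open>For \<open>t = 1\<close> the closed cone would contain the nonzero vector
      \<open>q - p\<close>, on which \<open>w\<close> vanishes, against the norm bound.\<close>
    moreover have "t \<noteq> 1"
    proof
      assume "t = 1"
      then have "norm (q - p) \<le> R * (w \<bullet> (q - p))" using t norm_closure[of "q - p"] by (simp add: le_def)
      then show False using p q \<open>p \<noteq> q\<close> by (simp add: inner_diff_right)
    qed
    ultimately have t1: "t > 1" by simp
    \<comment> \<open>The map t / (t - 1) is an involution, so \<open>?s\<close> is the exit
      parameter predicted by \<open>t\<close>. Below it, the point of the line is a positive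
      multiple of \<open>p\<close> plus an element of the closed cone, hence in
      \<open>K\<close>.\<close>
    let ?s = "t / (t - 1)"
    have "?\<gamma> s \<in> K" if s: "0 \<le> s" "s < ?s" for s
    proof -
      have "(1 - s / ?s) *\<^sub>R p + (s / t) *\<^sub>R (t *\<^sub>R q - p) \<in> K"
        using p(1) t s t1 by (intro add_K_closure scale_K scale_closure) (auto simp: le_def field_simps)
      moreover have "(1 - s / ?s) *\<^sub>R p + (s / t) *\<^sub>R (t *\<^sub>R q - p) = (1 - s / ?s - s / t) *\<^sub>R p + s *\<^sub>R q"
        using t1 by (simp add: algebra_simps)
      moreover have "1 - s / ?s - s / t = 1 - s" using t1 by (simp add: field_simps)
      moreover have "(1 - s) *\<^sub>R p + s *\<^sub>R q = ?\<gamma> s" by (simp add: algebra_simps)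
      ultimately show ?thesis by metis
    qed
    then have *: "s \<le> Sup S" if "0 \<le> s" "s < ?s" for s
      using that bdd by (intro cSup_upper) (auto simp: S_def)
    have "?s \<le> Sup S"
    proof (rule dense_le_bounded[of 0])
      show "0 < ?s" using t1 by simp
      show "s \<le> Sup S" if "0 < s" "s < ?s" for s using *[of s] that by simp
    qed
    then have "t \<le> Sup S * (t - 1)" using t1 by (simp add: field_simps)
    then have "Sup S \<le> t * (Sup S - 1)" by (simp add: algebra_simps)
    then show "Sup S / (Sup S - 1) \<le> t" using \<beta> by (simp add: field_simps)
  qed
qed

text \<open>Exchanging \<open>p\<close> and \<open>q\<close> turns the parameter \<open>s\<close>
  into \<open>1 - s\<close>, so the lower exit point comes from the same line result. All four
  distances are multiples of the distance from \<open>p\<close> to \<open>q\<close>, which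
  cancels.\<close>

lemma cross_ratio_gauge:
  fixes p q
  defines "S \<equiv> {s::real. p + s *\<^sub>R (q - p) \<in> K}"
  defines "a \<equiv> p + Inf S *\<^sub>R (q - p)" and "b \<equiv> p + Sup S *\<^sub>R (q - p)"
  assumes p: "p \<in> K" "w \<bullet> p = 1" and q: "q \<in> K" "w \<bullet> q = 1" and "p \<noteq> q"
  shows "(norm (p - b) * norm (q - a)) / (norm (p - a) * norm (q - b)) = gauge p q * gauge q p"
proof -
  let ?T = "{s::real. q + s *\<^sub>R (p - q) \<in> K}"
  note L = gauge_line[OF p q \<open>p \<noteq> q\<close>, folded S_def]
  note M = gauge_line[OF q p \<open>p \<noteq> q\<close>[symmetric]]
  have ST: "s \<in> S \<longleftrightarrow> 1 - s \<in> ?T" for s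
    by (simp add: S_def algebra_simps)
  have I: "Inf S = 1 - Sup ?T"
  proof (rule cInf_eq_non_empty)
    show "S \<noteq> {}" using p(1) by (auto simp: S_def intro!: exI[of _ 0])
    show "1 - Sup ?T \<le> s" if "s \<in> S" for s
      using cSup_upper[OF that[unfolded ST] M(1)] by simp
    fix y assume y: "\<And>s. s \<in> S \<Longrightarrow> y \<le> s"
    have "Sup ?T \<le> 1 - y"
    proof (rule cSup_least)
      show "?T \<noteq> {}" using q(1) by (auto intro!: exI[of _ 0])
      fix t assume "t \<in> ?T"
      then have "1 - t \<in> S" by (simp add: ST)
      then show "t \<le> 1 - y" using y[of "1 - t"] by simp
    qed
    then show "y \<le> 1 - Sup ?T" by simp
  qed
  have "p - a = (Sup ?T - 1) *\<^sub>R (q - p)" "q - a = Sup ?T *\<^sub>R (q - p)"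
    "p - b = (- Sup S) *\<^sub>R (q - p)" "q - b = (1 - Sup S) *\<^sub>R (q - p)"
    unfolding a_def b_def I by (simp_all add: algebra_simps)
  then have "norm (p - a) = (Sup ?T - 1) * norm (q - p)" "norm (q - a) = Sup ?T * norm (q - p)"
    "norm (p - b) = Sup S * norm (q - p)" "norm (q - b) = (Sup S - 1) * norm (q - p)"
    using L(2) M(2) by (simp_all only: norm_scaleR, simp_all)
  moreover have "norm (q - p) > 0" using \<open>p \<noteq> q\<close> by simp
  ultimately show ?thesis unfolding L(3) M(3) using L(2) M(2) by simp
qed

end

section \<open>Projective domains and their lifted automorphisms\<close>

lemma span_scaleR: "c \<noteq> 0 \<Longrightarrow> span {c *\<^sub>R v} = span {v}" for v :: "'a::real_vector"
proof -
  assume c: "c \<noteq> 0"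
  have "x \<in> range (\<lambda>k. k *\<^sub>R c *\<^sub>R v)" if x: "x \<in> range (\<lambda>k. k *\<^sub>R v)" for x
  proof -
    obtain k where "x = k *\<^sub>R v" using x by auto
    then have "x = (k / c) *\<^sub>R c *\<^sub>R v" using c by simp
    then show ?thesis by blast
  qed
  moreover have "x \<in> range (\<lambda>k. k *\<^sub>R v)" if "x \<in> range (\<lambda>k. k *\<^sub>R c *\<^sub>R v)" for x
    using that by auto
  ultimately show ?thesis unfolding span_singleton by blast
qed

lemma span_eqD: "span {u} = span {v} \<Longrightarrow> \<exists>c. v = c *\<^sub>R u" for u v :: "'a::real_vector"
  using span_base[of v "{v}"] by (auto simp: span_singleton)

lemma pact_pcls: "pact (pcls g) (span {v}) = span {g *v v}"
proof -
  have *: "(c *\<^sub>R g) *v (k *\<^sub>R v) = (c * k) *\<^sub>R (g *v v)" for c k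
    by (simp add: matrix_vector_mult_scaleR flip: scaleR_matrix_vector_assoc)
  have "x \<in> pact (pcls g) (span {v}) \<longleftrightarrow> (\<exists>c k. c \<noteq> 0 \<and> x = (c *\<^sub>R g) *v (k *\<^sub>R v))" for x
    unfolding pact_def pcls_def span_singleton by blast
  also have "\<dots> x \<longleftrightarrow> (\<exists>k. x = k *\<^sub>R (g *v v))" for x
    unfolding * by (metis mult_1 zero_neq_one)
  finally show ?thesis unfolding span_singleton by blast
qed

lemma pmul_pcls: "pmul (pcls g) (pcls h) = pcls (g ** h)"
proof -
  have *: "(c *\<^sub>R g) ** (d *\<^sub>R h) = (c * d) *\<^sub>R (g ** h)" for c d
    by (simp add: matrix_mult_scaleR_left matrix_mult_scaleR_right)
  have "x \<in> pmul (pcls g) (pcls h) \<longleftrightarrow> (\<exists>c d. c \<noteq> 0 \<and> d \<noteq> 0 \<and> x = (c *\<^sub>R g) ** (d *\<^sub>R h))" for x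
    unfolding pmul_def pcls_def by blast
  also have "\<dots> x \<longleftrightarrow> (\<exists>c. c \<noteq> 0 \<and> x = c *\<^sub>R (g ** h))" for x
    unfolding * by (metis mult_1 mult_eq_0_iff zero_neq_one)
  finally show ?thesis unfolding pcls_def by blast
qed

lemma pinv_pcls: "invertible g \<Longrightarrow> pinv (pcls g) = pcls (matrix_inv g)"
proof -
  assume g: "invertible g"
  have *: "matrix_inv (c *\<^sub>R g) = inverse c *\<^sub>R matrix_inv g" if "c \<noteq> 0" for c
    using that matrix_inv_right[OF g]
    by (intro matrix_inv_unique) (simp add: matrix_mult_scaleR_left matrix_mult_scaleR_right)
  have "x \<in> pinv (pcls g) \<longleftrightarrow> (\<exists>c. c \<noteq> 0 \<and> x = matrix_inv (c *\<^sub>R g))" for x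
    unfolding pinv_def pcls_def by blast
  also have "\<dots> x \<longleftrightarrow> (\<exists>c. c \<noteq> 0 \<and> x = c *\<^sub>R matrix_inv g)" for x
    by (metis * inverse_inverse_eq nonzero_imp_inverse_nonzero)
  finally show ?thesis unfolding pcls_def by blast
qed

lemma pcls_self: "g \<in> pcls g"
  unfolding pcls_def by (auto intro!: exI[of _ 1])

lemma det_scaleR: "det (c *\<^sub>R g) = c ^ CARD('n) * det g" for g :: "real^'n^'n"
proof -
  have "c *\<^sub>R g = mat c ** g"
    by (simp add: matrix_matrix_mult_def mat_def vec_eq_iff if_distrib[of "\<lambda>x. x * y" for y] cong: if_cong)
  moreover have "det (mat c :: real^'n^'n) = c ^ CARD('n)"
    by (subst det_diagonal) (auto simp: mat_def)
  ultimately show ?thesis by (simp add: det_mul)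
qed

text \<open>Of the two rays of a projective point off the hyperplane \<open>w = 0\<close>, this
  keeps the one on which \<open>w\<close> is positive. Projective sets thereby become cones whose
  slice at height 1 is \<open>lift w X\<close>.\<close>

definition pcone :: "real^'n \<Rightarrow> (real^'n) set set \<Rightarrow> (real^'n) set" where
  "pcone w X = {v. w \<bullet> v > 0 \<and> span {v} \<in> X}"

lemma lift_eq_pcone: "lift w X = pcone w X \<inter> {v. w \<bullet> v = 1}"
  by (auto simp: lift_def pcone_def)

lemma pcone_scale: "c > 0 \<Longrightarrow> v \<in> pcone w X \<Longrightarrow> c *\<^sub>R v \<in> pcone w X"
  by (simp add: pcone_def span_scaleR)

lemma pcone_normalize: "v \<in> pcone w X \<Longrightarrow> inverse (w \<bullet> v) *\<^sub>R v \<in> lift w X"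
  by (auto simp: pcone_def lift_def span_scaleR)

text \<open>After normalization to height 1, \<open>u + v\<close> is a positive multiple of the
  convex combination with weights proportional to the heights of \<open>u\<close> and
  \<open>v\<close>.\<close>

lemma pcone_add:
  assumes "convex (lift w X)" "u \<in> pcone w X" "v \<in> pcone w X" shows "u + v \<in> pcone w X"
proof -
  let ?a = "w \<bullet> u" and ?b = "w \<bullet> v"
  have ab: "?a > 0" "?b > 0" using assms by (auto simp: pcone_def)
  have "(?a / (?a + ?b)) *\<^sub>R (inverse ?a *\<^sub>R u) + (?b / (?a + ?b)) *\<^sub>R (inverse ?b *\<^sub>R v) \<in> lift w X"
    using ab pcone_normalize assms by (intro convexD[OF assms(1)]) (auto simp: add_divide_distrib[symmetric])
  moreover have "(?a / (?a + ?b)) *\<^sub>R (inverse ?a *\<^sub>R u) + (?b / (?a + ?b)) *\<^sub>R (inverse ?b *\<^sub>R v)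
      = inverse (?a + ?b) *\<^sub>R (u + v)"
  proof -
    have "a / (a + b) * inverse a = inverse (a + b)" "b / (a + b) * inverse b = inverse (a + b)"
      if "a > 0" "b > 0" for a b :: real using that by (simp_all add: field_simps)
    then show ?thesis using ab by (simp add: scaleR_add_right)
  qed
  ultimately have in_pcone: "inverse (?a + ?b) *\<^sub>R (u + v) \<in> pcone w X" by (auto simp: lift_eq_pcone)
  have "(?a + ?b) *\<^sub>R (inverse (?a + ?b) *\<^sub>R (u + v)) \<in> pcone w X"
    using ab by (intro pcone_scale[OF _ in_pcone]) auto
  moreover have "?a + ?b \<noteq> 0" using ab by simp
  then have "(?a + ?b) *\<^sub>R (inverse (?a + ?b) *\<^sub>R (u + v)) = u + v"
    unfolding scaleR_scaleR by (metis right_inverse scaleR_one)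
  ultimately show ?thesis by metis
qed

lemma pcone_eq_span: "u \<in> pcone w X \<Longrightarrow> v \<in> pcone w Y \<Longrightarrow> span {u} = span {v} \<Longrightarrow> \<exists>c>0. v = c *\<^sub>R u"
  using span_eqD[of u v] by (auto simp: pcone_def zero_less_mult_iff)

locale pdomain =
  fixes \<Omega> :: "(real^'n) set set"
  assumes properly_convex: "properly_convex \<Omega>"
begin

abbreviation "w \<equiv> chart \<Omega>"
abbreviation "K \<equiv> pcone w \<Omega>"

lemma proper_chart: "proper_chart w \<Omega>"
  using properly_convex unfolding properly_convex_def chart_def by (rule someI_ex)

lemma w_ne: "span {v} \<in> \<Omega> \<Longrightarrow> v \<noteq> 0 \<Longrightarrow> w \<bullet> v \<noteq> 0"
  using proper_chart span_base[of v "{v}"] unfolding proper_chart_def by blast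

lemma pcone_rep:
  assumes "X \<subseteq> \<Omega>" "x \<in> X" obtains v where "v \<in> pcone w X" "x = span {v}"
proof -
  obtain u where u: "x = span {u}" "u \<noteq> 0"
    using assms proper_chart unfolding proper_chart_def proj_space_def by blast
  then have "w \<bullet> u \<noteq> 0" using w_ne assms by blast
  then consider "w \<bullet> u > 0" | "w \<bullet> (- u) > 0" by fastforce
  then show ?thesis
  proof cases
    case 1 then show ?thesis using that u assms by (simp add: pcone_def)
  next
    case 2
    have "span {- u} = span {u}" using span_scaleR[of "-1" u] by simp
    then show ?thesis using that[of "- u"] 2 u assms by (simp add: pcone_def)
  qed
qed

definition R :: real where "R = (SOME r. \<forall>v\<in>lift w \<Omega>. norm v \<le> r)"

sublocale proper_cone K w R
proof
  have pc: "open (cone_of \<Omega>)" "bounded (lift w \<Omega>)" "convex (lift w \<Omega>)" "\<Omega> \<noteq> {}"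
    using proper_chart by (auto simp: proper_chart_def)
  have "K = cone_of \<Omega> \<inter> {v. w \<bullet> v > 0}" by (auto simp: pcone_def cone_of_def)
  then show "open K" using pc(1) open_halfspace_gt by (auto intro!: open_Int)
  show "K \<noteq> {}" using pc(4) pcone_rep[of \<Omega>] by blast
  show "u + v \<in> K" if "u \<in> K" "v \<in> K" for u v using pcone_add[OF pc(3) that] .
  show "c *\<^sub>R v \<in> K" if "c > 0" "v \<in> K" for c v using pcone_scale[OF that] .
  show pos: "w \<bullet> v > 0" if "v \<in> K" for v using that by (simp add: pcone_def)
  have "\<exists>r. \<forall>v\<in>lift w \<Omega>. norm v \<le> r" using pc(2) by (simp add: bounded_iff)
  then have R: "\<forall>v\<in>lift w \<Omega>. norm v \<le> R" unfolding R_def by (rule someI_ex)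
  show "norm v \<le> R * (w \<bullet> v)" if v: "v \<in> K" for v
  proof -
    have "norm (inverse (w \<bullet> v) *\<^sub>R v) \<le> R" using R pcone_normalize[OF v] by blast
    then show ?thesis using pos[OF v] by (simp add: field_simps)
  qed
qed

lemma chart_pt_span:
  assumes p: "p \<in> K" shows "chart_pt w (span {p}) = inverse (w \<bullet> p) *\<^sub>R p"
  unfolding chart_pt_def
proof (rule some_equality)
  show "inverse (w \<bullet> p) *\<^sub>R p \<in> span {p} \<and> w \<bullet> (inverse (w \<bullet> p) *\<^sub>R p) = 1"
    using pos_K[OF p] by (auto simp: span_singleton)
  fix v assume v: "v \<in> span {p} \<and> w \<bullet> v = 1"
  then obtain k where k: "v = k *\<^sub>R p" by (auto simp: span_singleton)
  then have "k * (w \<bullet> p) = 1" using v by simp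
  then show "v = inverse (w \<bullet> p) *\<^sub>R p" using k by (metis inverse_unique mult.commute)
qed

text \<open>The product of the two gauges is unchanged by positive rescaling of \<open>p\<close> and
  \<open>q\<close>, so arbitrary representatives may replace the chart points used in the definition
  of the metric.\<close>

lemma hilbert_gauge:
  assumes p: "p \<in> K" and q: "q \<in> K"
  shows "hilbert \<Omega> (span {p}) (span {q}) = ln (gauge p q * gauge q p) / 2"
proof (cases "span {p} = span {q}")
  case True
  then obtain c where c: "c > 0" "q = c *\<^sub>R p" using pcone_eq_span p q by blast
  have "gauge p q * gauge q p = 1"
    using gauge_scale[OF p p, of 1 c] gauge_scale[OF p p, of c 1] c gauge_self[OF p] by simp
  then show ?thesis using True by (simp add: hilbert_def)
next
  case False
  let ?p = "inverse (w \<bullet> p) *\<^sub>R p" and ?q = "inverse (w \<bullet> q) *\<^sub>R q"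
  have pos: "w \<bullet> p > 0" "w \<bullet> q > 0" using pos_K p q by auto
  have pq: "?p \<in> K" "w \<bullet> ?p = 1" "?q \<in> K" "w \<bullet> ?q = 1" using p q pos scale_K by auto
  have ne: "?p \<noteq> ?q"
  proof
    assume "?p = ?q"
    then have "span {?p} = span {?q}" by simp
    moreover have "span {?p} = span {p}" "span {?q} = span {q}" using pos by (intro span_scaleR; simp)+
    ultimately show False using False by simp
  qed
  have line: "w \<bullet> (x + s *\<^sub>R (y - x)) = 1" if "w \<bullet> x = 1" "w \<bullet> y = 1" for x y s
    using that by (simp add: inner_add_right inner_diff_right)
  have "{s::real. ?p + s *\<^sub>R (?q - ?p) \<in> lift w \<Omega>} = {s. ?p + s *\<^sub>R (?q - ?p) \<in> K}"
    unfolding lift_eq_pcone using line pq(2,4) by blast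
  then have "hilbert \<Omega> (span {p}) (span {q}) = ln (gauge ?p ?q * gauge ?q ?p) / 2"
    using False unfolding hilbert_def Let_def chart_pt_span[OF p] chart_pt_span[OF q]
    using cross_ratio_gauge[OF pq ne] by simp
  also have "gauge ?p ?q * gauge ?q ?p = gauge p q * gauge q p"
  proof -
    have e: "gauge ?p ?q = inverse (w \<bullet> p) / inverse (w \<bullet> q) * gauge p q"
      "gauge ?q ?p = inverse (w \<bullet> q) / inverse (w \<bullet> p) * gauge q p"
      using pos by (intro gauge_scale p q; simp)+
    show ?thesis unfolding e using pos by simp
  qed
  finally show ?thesis .
qed

text \<open>Determinant 1 or -1 fixes the scalar of a class up to sign, and preserving
  \<open>K\<close> rather than exchanging it with its negative fixes the sign.\<close>

definition linear_lifts :: "(real^'n^'n) set set \<Rightarrow> (real^'n^'n) set" where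
  "linear_lifts H = {g. \<bar>det g\<bar> = 1 \<and> (\<forall>v\<in>K. g *v v \<in> K) \<and> pcls g \<in> H}"

lemma linear_lifts_invertible: "g \<in> linear_lifts H \<Longrightarrow> invertible g"
  by (auto simp: linear_lifts_def invertible_det_nz)

text \<open>A representative \<open>h\<close> of an automorphism never sends a vector of
  \<open>K\<close> into the hyperplane \<open>w = 0\<close>. As \<open>K\<close> is convex,
  \<open>w\<close> has one sign on the image; \<open>s\<close> corrects this sign and
  \<open>r\<close> the determinant.\<close>

lemma linear_lifts_exist:
  assumes G: "G \<in> H" "H \<subseteq> Aut \<Omega>"
  obtains g where "g \<in> linear_lifts H" "G = pcls g"
proof -
  obtain h where h: "G = pcls h" "invertible h" using G by (auto simp: Aut_def PGL_def)
  have GO: "pact G ` \<Omega> = \<Omega>" using G by (auto simp: Aut_def)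
  have hO: "span {h *v v} \<in> \<Omega>" if "v \<in> K" for v
  proof -
    have "pact G (span {v}) \<in> \<Omega>" using that GO by (auto simp: pcone_def)
    then show ?thesis by (simp add: h(1) pact_pcls)
  qed
  have ne: "w \<bullet> (h *v v) \<noteq> 0" if v: "v \<in> K" for v
  proof (rule w_ne[OF hO[OF v]])
    show "h *v v \<noteq> 0"
    proof
      assume "h *v v = 0"
      then have "matrix_inv h *v (h *v v) = 0" by simp
      then have "v = 0" by (simp add: matrix_vector_mul_assoc matrix_inv_left[OF h(2)])
      then show False using pos_K[OF v] by simp
    qed
  qed
  have sign: False if "u \<in> K" "v \<in> K" "w \<bullet> (h *v u) > 0" "w \<bullet> (h *v v) < 0" for u v
  proof -
    \<comment> \<open>The weights are chosen so that \<open>w\<close> vanishes on the image of this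
      point of \<open>K\<close>.\<close>
    let ?z = "(- (w \<bullet> (h *v v))) *\<^sub>R u + (w \<bullet> (h *v u)) *\<^sub>R v"
    have "?z \<in> K" using that by (intro add_K scale_K) auto
    moreover have "w \<bullet> (h *v ?z) = 0"
      by (simp only: matrix_vector_right_distrib matrix_vector_mult_scaleR inner_add_right inner_scaleR_right) simp
    ultimately show False using ne by blast
  qed
  have "\<exists>s. \<bar>s\<bar> = 1 \<and> (\<forall>v\<in>K. s * (w \<bullet> (h *v v)) > 0)"
  proof (cases "\<exists>u\<in>K. w \<bullet> (h *v u) > 0")
    case True
    then have "\<forall>v\<in>K. w \<bullet> (h *v v) > 0" using sign ne by (meson linorder_neqE_linordered_idom)
    then show ?thesis by (intro exI[of _ 1]) auto
  next
    case False
    then have "\<forall>v\<in>K. w \<bullet> (h *v v) < 0" using ne by (meson linorder_neqE_linordered_idom)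
    then show ?thesis by (intro exI[of _ "-1"]) auto
  qed
  then obtain s where s: "\<bar>s\<bar> = 1" "\<forall>v\<in>K. s * (w \<bullet> (h *v v)) > 0" by blast
  have d: "\<bar>det h\<bar> > 0" using h(2) by (simp add: invertible_det_nz)
  define r where "r = inverse (root CARD('n) \<bar>det h\<bar>)"
  have r: "r > 0" using d by (simp add: r_def)
  have rn: "r ^ CARD('n) * \<bar>det h\<bar> = 1" using d by (simp add: r_def power_inverse)
  let ?g = "(s * r) *\<^sub>R h"
  have sr: "s * r \<noteq> 0" using s(1) r by auto
  have dg: "\<bar>det ?g\<bar> = 1" using s(1) r rn by (simp add: det_scaleR abs_mult power_abs power_mult_distrib)
  have gK: "?g *v v \<in> K" if v: "v \<in> K" for v
  proof -
    have e: "?g *v v = (s * r) *\<^sub>R (h *v v)" by (simp flip: scaleR_matrix_vector_assoc)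
    have "w \<bullet> (?g *v v) = r * (s * (w \<bullet> (h *v v)))" unfolding e by simp
    then have "w \<bullet> (?g *v v) > 0" using s(2) v r by simp
    moreover have "span {?g *v v} \<in> \<Omega>" unfolding e by (simp only: span_scaleR[OF sr] hO[OF v])
    ultimately show ?thesis by (simp add: pcone_def)
  qed
  have pg: "pcls ?g = G" unfolding h(1) pcls_def
  proof (intro set_eqI iffI)
    fix x assume "x \<in> {c *\<^sub>R ?g | c. c \<noteq> 0}"
    then obtain c where "c \<noteq> 0" "x = c *\<^sub>R ?g" by blast
    then have "x = (c * (s * r)) *\<^sub>R h" "c * (s * r) \<noteq> 0" using sr by auto
    then show "x \<in> {c *\<^sub>R h | c. c \<noteq> 0}" by blast
  next
    fix x assume "x \<in> {c *\<^sub>R h | c. c \<noteq> 0}"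
    then obtain c where "c \<noteq> 0" "x = c *\<^sub>R h" by blast
    then have "x = (c / (s * r)) *\<^sub>R ?g" "c / (s * r) \<noteq> 0" using sr by auto
    then show "x \<in> {c *\<^sub>R ?g | c. c \<noteq> 0}" by blast
  qed
  have "?g \<in> linear_lifts H" unfolding linear_lifts_def
    using dg gK G(1) by (intro CollectI conjI ballI) (simp_all only: pg)
  then show ?thesis using that pg by metis
qed

text \<open>Two lifts of one class differ by a scalar, which is positive because both preserve
  \<open>K\<close>, and is then 1 by the determinant. Hence identities in the projective group
  become matrix identities.\<close>

lemma linear_lifts_unique:
  assumes "g \<in> linear_lifts H" "h \<in> linear_lifts H'" "pcls g = pcls h" shows "g = h"
proof -
  obtain c where c: "g = c *\<^sub>R h" "c \<noteq> 0" using pcls_self[of g] assms(3) by (auto simp: pcls_def)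
  obtain v where v: "v \<in> K" using K_ne by blast
  have "g *v v \<in> K" "h *v v \<in> K" using assms v by (auto simp: linear_lifts_def)
  moreover have "g *v v = c *\<^sub>R (h *v v)" unfolding c(1) by (simp flip: scaleR_matrix_vector_assoc)
  ultimately have "c * (w \<bullet> (h *v v)) > 0" "w \<bullet> (h *v v) > 0" using pos_K by force+
  then have "c > 0" by (simp add: zero_less_mult_iff)
  moreover have "\<bar>det g\<bar> = 1" "\<bar>det h\<bar> = 1" using assms by (auto simp: linear_lifts_def)
  ultimately have "c ^ CARD('n) = 1" using c(1) by (simp add: det_scaleR abs_mult)
  then have "c = 1" using \<open>c > 0\<close> power_eq_imp_eq_base[of c "CARD('n)" 1] by simp
  then show ?thesis using c by simp
qed

lemma linear_lifts_group:
  assumes H: "pgl_subgroup H" "H \<subseteq> Aut \<Omega>"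
  shows "mat 1 \<in> linear_lifts H"
    and "\<And>g h. g \<in> linear_lifts H \<Longrightarrow> h \<in> linear_lifts H \<Longrightarrow> g ** h \<in> linear_lifts H"
    and "\<And>g. g \<in> linear_lifts H \<Longrightarrow> matrix_inv g \<in> linear_lifts H"
proof -
  show "mat 1 \<in> linear_lifts H" using H(1) by (simp add: linear_lifts_def pgl_subgroup_def pone_def)
  show "g ** h \<in> linear_lifts H" if "g \<in> linear_lifts H" "h \<in> linear_lifts H" for g h
  proof -
    have "pmul (pcls g) (pcls h) \<in> H" using that H(1) by (simp add: linear_lifts_def pgl_subgroup_def)
    then have "pcls (g ** h) \<in> H" by (simp add: pmul_pcls)
    then show ?thesis using that by (simp add: linear_lifts_def det_mul abs_mult flip: matrix_vector_mul_assoc)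
  qed
  show "matrix_inv g \<in> linear_lifts H" if g: "g \<in> linear_lifts H" for g
  proof -
    note inv = linear_lifts_invertible[OF g]
    have "pinv (pcls g) \<in> H" using g H(1) by (simp add: linear_lifts_def pgl_subgroup_def)
    then have gi: "pcls (matrix_inv g) \<in> H" by (simp add: pinv_pcls[OF inv])
    have "det g * det (matrix_inv g) = 1" using matrix_inv_right[OF inv] by (metis det_I det_mul)
    then have "\<bar>det g\<bar> * \<bar>det (matrix_inv g)\<bar> = 1" by (metis abs_mult abs_one)
    then have "\<bar>det (matrix_inv g)\<bar> = 1" using g by (simp add: linear_lifts_def)
    \<comment> \<open>The image of \<open>v\<close> lies over the domain, so it is in
      \<open>K\<close> or in its negative; the latter is impossible because \<open>g\<close> would
      map it back to \<open>v\<close>.\<close>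
    moreover have "matrix_inv g *v v \<in> K" if v: "v \<in> K" for v
    proof -
      let ?u = "matrix_inv g *v v"
      have gu: "g *v ?u = v" by (simp add: matrix_vector_mul_assoc matrix_inv_right[OF inv])
      have "pact (pcls (matrix_inv g)) (span {v}) \<in> \<Omega>" using gi H(2) v by (auto simp: Aut_def pcone_def)
      then have uO: "span {?u} \<in> \<Omega>" by (simp add: pact_pcls)
      have "?u \<noteq> 0" using gu pos_K[OF v] by auto
      then have "w \<bullet> ?u \<noteq> 0" using w_ne uO by blast
      moreover have "\<not> w \<bullet> ?u < 0"
      proof
        assume "w \<bullet> ?u < 0"
        then have "(-1) *\<^sub>R ?u \<in> K" using uO span_scaleR[of "-1" ?u] by (simp add: pcone_def)
        then have "g *v ((-1) *\<^sub>R ?u) \<in> K" using g unfolding linear_lifts_def by blast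
        then have "- v \<in> K" by (simp only: matrix_vector_mult_scaleR gu) simp
        then show False using pos_K[of "- v"] pos_K[OF v] by simp
      qed
      ultimately show ?thesis using uO by (simp add: pcone_def)
    qed
    ultimately show ?thesis using gi by (simp add: linear_lifts_def)
  qed
qed

end

section \<open>Minimal sets of naive convex co-compact triples\<close>

locale naive_triple = pdomain \<Omega> for \<Omega> :: "(real^'n) set set" +
  fixes C :: "(real^'n) set set" and \<Lambda> :: "(real^'n^'n) set set"
  assumes naive_cc: "naive_cc \<Omega> C \<Lambda>"
begin

abbreviation "D \<equiv> pcone w C"
abbreviation "L \<equiv> linear_lifts \<Lambda>"

lemma group_\<Lambda>: "pgl_subgroup \<Lambda>" and \<Lambda>_Aut: "\<Lambda> \<subseteq> Aut \<Omega>" and C_\<Omega>: "C \<subseteq> \<Omega>"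
  using naive_cc by (auto simp: naive_cc_def)

text \<open>Invariance is read off from cocompactness: \<open>C\<close> is the union of the
  translates of one set, and left multiplication carries translates to translates.\<close>

lemma \<Lambda>_C:
  assumes "G \<in> \<Lambda>" "x \<in> C" shows "pact G x \<in> C"
proof -
  obtain K0 where K0: "K0 \<subseteq> C" "(\<Union>G\<in>\<Lambda>. pact G ` K0) = C"
    using naive_cc by (auto simp: naive_cc_def cocompact_def)
  then obtain H k where H: "H \<in> \<Lambda>" "k \<in> K0" "x = pact H k" using assms(2) by blast
  obtain g where g: "g \<in> L" "G = pcls g" using linear_lifts_exist[OF assms(1) \<Lambda>_Aut] .
  obtain h where h: "h \<in> L" "H = pcls h" using linear_lifts_exist[OF H(1) \<Lambda>_Aut] .
  obtain v where v: "k = span {v}" using pcone_rep[OF C_\<Omega>] K0(1) H(2) by blast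
  have "pact G x = pact (pcls (g ** h)) k"
    by (simp add: H(3) g h v pact_pcls matrix_vector_mul_assoc)
  moreover have "pcls (g ** h) \<in> \<Lambda>"
    using linear_lifts_group(2)[OF group_\<Lambda> \<Lambda>_Aut g(1) h(1)] by (simp add: linear_lifts_def)
  ultimately show ?thesis using K0(2) H(2) by blast
qed

text \<open>\<open>pcompact\<close> speaks of unit vectors of both signs. As \<open>w\<close> does
  not vanish on them, the open condition \<open>w \<bullet> v > 0\<close> selects the same vectors
  as a closed half-space.\<close>

lemma compact_slice:
  assumes "pcompact X" "X \<subseteq> \<Omega>"
  shows "compact {v \<in> pcone w X. norm v = 1}"
proof -
  have "w \<bullet> v \<noteq> 0" if "norm v = 1" "span {v} \<in> X" for v
    using w_ne[of v] that assms(2) by fastforce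
  then have "{v \<in> pcone w X. norm v = 1} = {v. norm v = 1 \<and> span {v} \<in> X} \<inter> {v. w \<bullet> v \<ge> 0}"
    by (fastforce simp: pcone_def)
  then show ?thesis using assms(1) closed_halfspace_ge[of 0 w]
    by (simp add: pcompact_def compact_Int_closed)
qed

lemma pcompact_span_image:
  assumes Q: "compact Q" "Q \<subseteq> K" shows "pcompact ((\<lambda>v. span {v}) ` Q)"
proof -
  have n0: "v \<noteq> 0" if "v \<in> Q" for v using that Q(2) pos_K by force
  let ?n = "\<lambda>v. inverse (norm v) *\<^sub>R v"
  have "{v. norm v = 1 \<and> span {v} \<in> (\<lambda>v. span {v}) ` Q} = ?n ` Q \<union> (\<lambda>v. - ?n v) ` Q"
  proof (intro equalityI subsetI)
    fix v assume "v \<in> {v. norm v = 1 \<and> span {v} \<in> (\<lambda>v. span {v}) ` Q}"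
    then obtain q where q: "norm v = 1" "q \<in> Q" "span {q} = span {v}" by auto
    then obtain c where c: "v = c *\<^sub>R q" using span_eqD by blast
    then have "\<bar>c\<bar> = inverse (norm q)" using q n0[OF q(2)] by (simp add: field_simps)
    then have "c = inverse (norm q) \<or> c = - inverse (norm q)" by linarith
    then have "v = ?n q \<or> v = - ?n q" using c by auto
    then show "v \<in> ?n ` Q \<union> (\<lambda>v. - ?n v) ` Q" using q(2) by blast
  next
    fix v assume "v \<in> ?n ` Q \<union> (\<lambda>v. - ?n v) ` Q"
    then obtain q where q: "q \<in> Q" "v = ?n q \<or> v = (- inverse (norm q)) *\<^sub>R q" by auto
    have "span {?n q} = span {q}" "span {(- inverse (norm q)) *\<^sub>R q} = span {q}"
      using n0[OF q(1)] by (intro span_scaleR; simp)+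
    then show "v \<in> {v. norm v = 1 \<and> span {v} \<in> (\<lambda>v. span {v}) ` Q}" using q n0[OF q(1)] by auto
  qed
  moreover have "compact (?n ` Q \<union> (\<lambda>v. - ?n v) ` Q)"
    using n0 by (intro compact_Un compact_continuous_image Q(1) continuous_intros) auto
  moreover have "(\<lambda>v. span {v}) ` Q \<subseteq> proj_space" using n0 unfolding proj_space_def by blast
  ultimately show ?thesis by (simp add: pcompact_def)
qed

lemma cc_cone_exists: "\<exists>Q. cc_cone K w R L D Q"
proof -
  obtain K0 where K0: "K0 \<subseteq> C" "pcompact K0" "(\<Union>G\<in>\<Lambda>. pact G ` K0) = C"
    using naive_cc by (auto simp: naive_cc_def cocompact_def)
  let ?Q = "{v \<in> pcone w K0. norm v = 1}"
  have "cc_cone K w R L D ?Q"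
  proof
    note grp = linear_lifts_group[OF group_\<Lambda> \<Lambda>_Aut]
    show "mat 1 \<in> L" by (rule grp)
    show "g ** h \<in> L" if "g \<in> L" "h \<in> L" for g h using grp(2) that .
    show "invertible g" if "g \<in> L" for g using linear_lifts_invertible that .
    show "matrix_inv g \<in> L" if "g \<in> L" for g using grp(3) that .
    show LK: "g *v v \<in> K" if "g \<in> L" "v \<in> K" for g v using that by (simp add: linear_lifts_def)
    show "D \<subseteq> K" using C_\<Omega> by (auto simp: pcone_def)
    show "g *v v \<in> D" if "g \<in> L" "v \<in> D" for g v
    proof -
      have "pact (pcls g) (span {v}) \<in> C" using that by (intro \<Lambda>_C) (auto simp: linear_lifts_def pcone_def)
      moreover have "g *v v \<in> K" using LK that \<open>D \<subseteq> K\<close> by blast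
      ultimately show ?thesis by (simp add: pact_pcls pcone_def)
    qed
    obtain e where e: "e > 0" "\<forall>G\<in>\<Lambda>. \<forall>g\<in>G. \<bar>det g\<bar> = 1 \<and> dist g (mat 1) < e \<longrightarrow> G = pone"
      using naive_cc by (auto simp: naive_cc_def discrete_pgl_def)
    \<comment> \<open>Discreteness gives only the trivial class; uniqueness of lifts turns this into
      the identity matrix.\<close>
    have "g = mat 1" if "g \<in> L" "dist g (mat 1) < e" for g
    proof -
      have "pcls g = pone" using that e(2) pcls_self[of g] by (auto simp: linear_lifts_def)
      then show ?thesis using linear_lifts_unique[OF that(1) grp(1)] by (simp add: pone_def)
    qed
    then show "\<exists>e>0. \<forall>g\<in>L. dist g (mat 1) < e \<longrightarrow> g = mat 1" using e(1) by blast
    show "D \<noteq> {}" using naive_cc pcone_rep[OF C_\<Omega>] by (auto simp: naive_cc_def)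
    show "u + v \<in> D" if "u \<in> D" "v \<in> D" for u v
      using naive_cc that by (intro pcone_add) (auto simp: naive_cc_def pconvex_def)
    show "c *\<^sub>R v \<in> D" if "c > 0" "v \<in> D" for c v using pcone_scale that .
    show "compact ?Q" using K0 C_\<Omega> by (intro compact_slice) auto
    show "?Q \<subseteq> D" using K0(1) by (auto simp: pcone_def)
    show "\<exists>g\<in>L. \<exists>q\<in>?Q. \<exists>c>0. v = c *\<^sub>R (g *v q)" if v: "v \<in> D" for v
    proof -
      have "span {v} \<in> C" using v by (simp add: pcone_def)
      then obtain G k where G: "G \<in> \<Lambda>" "k \<in> K0" "span {v} = pact G k" using K0(3) by blast
      obtain g where g: "g \<in> L" "G = pcls g" using linear_lifts_exist[OF G(1) \<Lambda>_Aut] .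
      obtain u where u: "u \<in> pcone w K0" "k = span {u}" using pcone_rep[of K0 k] K0(1) C_\<Omega> G(2) by blast
      have u0: "u \<noteq> 0" using u(1) by (auto simp: pcone_def)
      let ?u = "inverse (norm u) *\<^sub>R u"
      have uQ: "?u \<in> ?Q" using pcone_scale[OF _ u(1), of "inverse (norm u)"] u0 by simp
      have "span {?u} = k" using u0 u(2) by (simp add: span_scaleR)
      then have "span {v} = span {g *v ?u}" using G(3) g(2) by (simp add: pact_pcls flip: \<open>span {?u} = k\<close>)
      moreover have "?u \<in> K" using uQ K0(1) C_\<Omega> by (auto simp: pcone_def)
      then have "g *v ?u \<in> K" using LK g(1) by blast
      ultimately obtain c where "c > 0" "v = c *\<^sub>R (g *v ?u)" using pcone_eq_span v by metis
      then show ?thesis using g(1) uQ by blast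
    qed
  qed
  then show ?thesis by blast
qed

end

section \<open>Minimal sets as common subeigenvectors\<close>

context pdomain
begin

notation le (infix "\<preceq>" 50)

text \<open>The displacement is half the logarithm of a product of two gauges, each at least its
  Collatz-Wielandt number. The point \<open>y\<close> attains both bounds and so identifies the
  translation length. Equality of the products then forces equality in each factor.\<close>

lemma Min_set_iff:
  assumes g: "g \<in> linear_lifts H" and h: "h = matrix_inv g" "h \<in> linear_lifts H"
    and y: "y \<in> K" "g *v y \<preceq> cw ((*v) g) *\<^sub>R y" "h *v y \<preceq> cw ((*v) h) *\<^sub>R y"
    and x: "x \<in> K"
  shows "span {x} \<in> Min_set \<Omega> (pcls g) \<longleftrightarrow>
    g *v x \<preceq> cw ((*v) g) *\<^sub>R x \<and> h *v x \<preceq> cw ((*v) h) *\<^sub>R x"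
proof -
  let ?cg = "cw ((*v) g)" and ?ch = "cw ((*v) h)"
  define \<delta> where "\<delta> a u = gauge (a *v u) u" for a :: "real^'n^'n" and u
  have gK: "g *v u \<in> K" and hK: "h *v u \<in> K" if "u \<in> K" for u
    using that g h(2) by (auto simp: linear_lifts_def)
  have hg: "h *v (g *v u) = u" "g *v (h *v u) = u" for u
    unfolding matrix_vector_mul_assoc h(1)
    by (simp_all add: matrix_inv_left matrix_inv_right linear_lifts_invertible[OF g])
  have cm: "cone_map ((*v) g)" "cone_map ((*v) h)" using gK hK by (auto simp: cone_map_def)
  have hil: "hilbert \<Omega> (span {u}) (pact (pcls g) (span {u})) = ln (\<delta> g u * \<delta> h u) / 2" if u: "u \<in> K" for u
  proof -
    \<comment> \<open>Applying \<open>h\<close> or \<open>g\<close> to the inequality shows that the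
      gauge of \<open>u\<close> over \<open>g u\<close> is the displacement gauge of the
      inverse.\<close>
    have "u \<preceq> t *\<^sub>R (g *v u) \<longleftrightarrow> h *v u \<preceq> t *\<^sub>R u" for t
      using cone_map_le[OF cm(2), of u "t *\<^sub>R (g *v u)"] cone_map_le[OF cm(1), of "h *v u" "t *\<^sub>R u"]
      by (auto simp: matrix_vector_mult_scaleR hg)
    then have "gauge u (g *v u) = \<delta> h u" by (simp add: gauge_def \<delta>_def)
    then show ?thesis using hilbert_gauge[OF u gK[OF u]] by (simp add: pact_pcls \<delta>_def mult.commute)
  qed
  have pos: "\<delta> g u > 0" "\<delta> h u > 0" if "u \<in> K" for u
    using that gK hK by (auto simp: \<delta>_def intro: gauge_pos)
  have le: "?cg \<le> \<delta> g u" "?ch \<le> \<delta> h u" if u: "u \<in> K" for u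
    using cw_le[OF u pos(1)[OF u]] cw_le[OF u pos(2)[OF u]] le_gauge[OF gK[OF u] u] le_gauge[OF hK[OF u] u]
    by (auto simp: \<delta>_def)
  have iff: "\<delta> g u = ?cg \<longleftrightarrow> g *v u \<preceq> ?cg *\<^sub>R u" "\<delta> h u = ?ch \<longleftrightarrow> h *v u \<preceq> ?ch *\<^sub>R u" if u: "u \<in> K" for u
    using le_gauge[OF gK[OF u] u] le_gauge[OF hK[OF u] u] gauge_lower[OF gK[OF u] u, of ?cg]
      gauge_lower[OF hK[OF u] u, of ?ch] le[OF u] by (auto simp: \<delta>_def)
  have ey: "\<delta> g y = ?cg" "\<delta> h y = ?ch" using iff[OF y(1)] y(2,3) by auto
  have cpos: "?cg > 0" "?ch > 0" using pos[OF y(1)] ey by auto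
  have tl: "transl_len \<Omega> (pcls g) = ln (?cg * ?ch) / 2"
    unfolding transl_len_def
  proof (rule cInf_eq_minimum)
    have "span {y} \<in> \<Omega>" using y(1) by (simp add: pcone_def)
    then show "ln (?cg * ?ch) / 2 \<in> (\<lambda>x. hilbert \<Omega> x (pact (pcls g) x)) ` \<Omega>"
      using hil[OF y(1)] ey by (intro image_eqI[of _ _ "span {y}"]) auto
    fix r assume "r \<in> (\<lambda>x. hilbert \<Omega> x (pact (pcls g) x)) ` \<Omega>"
    then obtain z where z: "z \<in> \<Omega>" "r = hilbert \<Omega> z (pact (pcls g) z)" by blast
    obtain u where u: "u \<in> K" "z = span {u}" using pcone_rep[OF subset_refl z(1)] .
    have "?cg * ?ch \<le> \<delta> g u * \<delta> h u" using le[OF u(1)] cpos pos[OF u(1)] by (intro mult_mono) auto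
    then show "ln (?cg * ?ch) / 2 \<le> r"
      using z(2) u hil[OF u(1)] cpos pos[OF u(1)] by simp
  qed
  have xO: "span {x} \<in> \<Omega>" using x by (simp add: pcone_def)
  have "span {x} \<in> Min_set \<Omega> (pcls g) \<longleftrightarrow> \<delta> g x * \<delta> h x = ?cg * ?ch"
    using xO cpos pos[OF x] by (simp add: Min_set_def tl hil[OF x])
  also have "\<dots> \<longleftrightarrow> \<delta> g x = ?cg \<and> \<delta> h x = ?ch"
  proof
    assume eq: "\<delta> g x * \<delta> h x = ?cg * ?ch"
    have "?cg * ?ch \<le> ?cg * \<delta> h x" "?cg * \<delta> h x \<le> \<delta> g x * \<delta> h x"
      using le[OF x] cpos pos[OF x] by (auto intro: mult_left_mono mult_right_mono)
    then have "?cg * \<delta> h x = ?cg * ?ch" "?cg * \<delta> h x = \<delta> g x * \<delta> h x" using eq by auto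
    then show "\<delta> g x = ?cg \<and> \<delta> h x = ?ch" using cpos pos[OF x] by auto
  qed auto
  finally show ?thesis using iff[OF x] by simp
qed

end

theorem mainTheorem2:
  fixes \<Omega> C :: "(real^'n) set set" and \<Lambda> A :: "(real^'n^'n) set set"
  assumes "naive_cc \<Omega> C \<Lambda>"
    and "pgl_subgroup A" and "A \<subseteq> \<Lambda>"
    and "\<forall>a\<in>A. \<forall>b\<in>A. pmul a b = pmul b a"
  shows "C \<inter> (\<Inter>a\<in>A. Min_set \<Omega> a) \<noteq> {}
     \<and> cocompact (centralizer \<Lambda> A) (conv_hull_in \<Omega> (C \<inter> (\<Inter>a\<in>A. Min_set \<Omega> a)))"
proof -
  interpret naive_triple \<Omega> C \<Lambda>
    by unfold_locales (use assms(1) in \<open>auto simp: naive_cc_def\<close>)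
  obtain Q where "cc_cone K w R L D Q" using cc_cone_exists by blast
  then interpret cc_cone K w R L D Q .
  write le (infix "\<preceq>" 50)
  let ?A = "linear_lifts A"
  have A_Aut: "A \<subseteq> Aut \<Omega>" using assms(3) \<Lambda>_Aut by blast
  have AL: "?A \<subseteq> L" using assms(3) by (auto simp: linear_lifts_def)
  have Ainv: "matrix_inv a \<in> ?A" if "a \<in> ?A" for a
    using linear_lifts_group(3)[OF assms(2) A_Aut that] .
  \<comment> \<open>Both products are lifts, so by uniqueness no scalar can appear between
    them.\<close>
  have commute_iff: "pmul (pcls a) (pcls b) = pmul (pcls b) (pcls a) \<longleftrightarrow> a ** b = b ** a"
    if "a \<in> L" "b \<in> L" for a b
    unfolding pmul_pcls using linear_lifts_unique[OF mul_L[OF that] mul_L[OF that(2,1)]] by auto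
  have Acomm: "a ** b = b ** a" if "a \<in> ?A" "b \<in> ?A" for a b
  proof -
    have "pcls a \<in> A" "pcls b \<in> A" using that by (auto simp: linear_lifts_def)
    then show ?thesis using commute_iff[of a b] that AL assms(4) by blast
  qed
  have centr: "pcls z \<in> centralizer \<Lambda> A \<longleftrightarrow> (\<forall>a\<in>?A. z ** a = a ** z)" if z: "z \<in> L" for z
  proof
    assume "pcls z \<in> centralizer \<Lambda> A"
    then have "\<forall>a\<in>?A. pmul (pcls z) (pcls a) = pmul (pcls a) (pcls z)"
      by (auto simp: centralizer_def linear_lifts_def)
    then show "\<forall>a\<in>?A. z ** a = a ** z" using commute_iff[OF z] AL by blast
  next
    assume za: "\<forall>a\<in>?A. z ** a = a ** z"
    have "pmul (pcls z) G = pmul G (pcls z)" if G: "G \<in> A" for G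
    proof -
      obtain a where a: "a \<in> ?A" "G = pcls a" using linear_lifts_exist[OF G A_Aut] .
      then show ?thesis using za by (simp add: pmul_pcls)
    qed
    moreover have "pcls z \<in> \<Lambda>" using z by (simp add: linear_lifts_def)
    ultimately show "pcls z \<in> centralizer \<Lambda> A" by (simp add: centralizer_def)
  qed
  let ?M = "C \<inter> (\<Inter>a\<in>A. Min_set \<Omega> a)" and ?Mc = "Min_cone ?A"
  note MC = Min_cone_cocompact[OF AL Ainv Acomm]
  obtain y where y: "y \<in> ?Mc" using MC(1) by blast
  \<comment> \<open>The single point \<open>y\<close> attains the bounds for all \<open>a\<close>
    simultaneously, so \<open>Min_set_iff\<close> applies to every element of the group. Closure
    under inverses absorbs the second inequality.\<close>
  have M_iff: "span {x} \<in> ?M \<longleftrightarrow> x \<in> ?Mc" if x: "x \<in> K" for x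
  proof -
    have K: "y \<in> K" using y D_K by (auto simp: Min_cone_def)
    have "span {x} \<in> Min_set \<Omega> (pcls a) \<longleftrightarrow> a *v x \<preceq> cw ((*v) a) *\<^sub>R x \<and>
        matrix_inv a *v x \<preceq> cw ((*v) (matrix_inv a)) *\<^sub>R x" if a: "a \<in> ?A" for a
      using y a Ainv[OF a] by (intro Min_set_iff[OF a refl Ainv[OF a] K _ _ x]) (auto simp: Min_cone_def)
    moreover have "(\<forall>G\<in>A. span {x} \<in> Min_set \<Omega> G) \<longleftrightarrow> (\<forall>a\<in>?A. span {x} \<in> Min_set \<Omega> (pcls a))"
      using linear_lifts_exist[OF _ A_Aut] by (metis (no_types, lifting) linear_lifts_def mem_Collect_eq)
    moreover have "span {x} \<in> C \<longleftrightarrow> x \<in> D" using x by (simp add: pcone_def)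
    ultimately show ?thesis using Ainv by (auto simp: Min_cone_def)
  qed
  have McK: "?Mc \<subseteq> K" using D_K by (auto simp: Min_cone_def)
  have cone_M: "pcone w ?M = ?Mc"
  proof
    show "?Mc \<subseteq> pcone w ?M" using M_iff McK by (auto simp: pcone_def)
    show "pcone w ?M \<subseteq> ?Mc"
    proof
      fix v assume v: "v \<in> pcone w ?M"
      then have "v \<in> K" using C_\<Omega> by (auto simp: pcone_def)
      then show "v \<in> ?Mc" using v M_iff[of v] unfolding pcone_def by blast
    qed
  qed
  have M_ne: "?M \<noteq> {}" using y M_iff McK by blast
  have M\<Omega>: "?M \<subseteq> \<Omega>" using C_\<Omega> by blast
  have "?M \<subseteq> pclosure \<Omega>"
  proof
    fix x assume "x \<in> ?M"
    then obtain v where v: "v \<in> pcone w ?M" "x = span {v}" using pcone_rep[OF M\<Omega>] by metis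
    then have "v \<in> cone_of \<Omega>" using M\<Omega> by (auto simp: pcone_def cone_of_def)
    then show "x \<in> pclosure \<Omega>" using v(2) closure_subset[of "cone_of \<Omega>"]
      unfolding pclosure_def by (auto simp: cone_of_def)
  qed
  moreover have "convex (lift w ?M)"
  proof -
    have add: "u + v \<in> ?Mc" if "u \<in> ?Mc" "v \<in> ?Mc" for u v
      using that D_add le_add by (fastforce simp: Min_cone_def matrix_vector_right_distrib scaleR_add_right)
    have scale: "c *\<^sub>R v \<in> ?Mc" if "c > 0" "v \<in> ?Mc" for c v
      using pcone_scale[of c v w ?M] that cone_M by simp
    have "convex ?Mc"
    proof (rule convexI)
      fix u v :: "real^'n" and a b :: real
      assume uv: "u \<in> ?Mc" "v \<in> ?Mc" and ab: "0 \<le> a" "0 \<le> b" "a + b = 1"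
      consider "a = 0" | "b = 0" | "a > 0" "b > 0" using ab by linarith
      then show "a *\<^sub>R u + b *\<^sub>R v \<in> ?Mc" using uv ab add scale by cases auto
    qed
    then show ?thesis unfolding lift_eq_pcone cone_M
      by (intro convex_Int convex_hyperplane)
  qed
  ultimately have "pconvex \<Omega> ?M" by (simp add: pconvex_def)
  \<comment> \<open>The set is itself a member of the family whose intersection is the hull.\<close>
  then have hull: "conv_hull_in \<Omega> ?M = ?M" unfolding conv_hull_in_def by blast
  obtain Q' where Q': "compact Q'" "Q' \<subseteq> ?Mc"
    "\<And>x. x \<in> ?Mc \<Longrightarrow> \<exists>z\<in>L. \<exists>q\<in>Q'. \<exists>c>0. (\<forall>a\<in>?A. z ** a = a ** z) \<and> x = c *\<^sub>R (z *v q)"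
    using MC(2) by metis
  let ?K' = "(\<lambda>v. span {v}) ` Q'"
  have "cocompact (centralizer \<Lambda> A) ?M" unfolding cocompact_def
  proof (intro exI[of _ ?K'] conjI equalityI subsetI)
    show K'M: "x \<in> ?M" if x: "x \<in> ?K'" for x
    proof -
      obtain v where "v \<in> Q'" "x = span {v}" using x by blast
      then show ?thesis using M_iff[of v] Q'(2) McK by blast
    qed
    show "pcompact ?K'" using Q'(1,2) McK by (intro pcompact_span_image) auto
    show "x \<in> (\<Union>G\<in>centralizer \<Lambda> A. pact G ` ?K')" if x: "x \<in> ?M" for x
    proof -
      obtain v where v: "v \<in> pcone w ?M" "x = span {v}" using pcone_rep[OF M\<Omega> x] .
      then have "v \<in> ?Mc" using cone_M by blast
      from Q'(3)[OF this] obtain z q c where z: "z \<in> L" "q \<in> Q'" "c > 0" "\<forall>a\<in>?A. z ** a = a ** z"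
        "v = c *\<^sub>R (z *v q)" by blast
      have "x = pact (pcls z) (span {q})" using v(2) z(3,5) by (simp add: pact_pcls span_scaleR)
      then show ?thesis using z(2) centr[OF z(1)] z(4) by blast
    qed
    fix x assume "x \<in> (\<Union>G\<in>centralizer \<Lambda> A. pact G ` ?K')"
    then obtain G q where G: "G \<in> centralizer \<Lambda> A" "q \<in> Q'" "x = pact G (span {q})" by blast
    then have "G \<in> \<Lambda>" by (simp add: centralizer_def)
    then obtain z where z: "z \<in> L" "G = pcls z" using linear_lifts_exist[OF _ \<Lambda>_Aut] by blast
    have za: "\<forall>a\<in>?A. z ** a = a ** z" using centr[OF z(1)] G(1) z(2) by blast
    have q: "q \<in> ?Mc" using G(2) Q'(2) by blast
    \<comment> \<open>The converse inclusion: a centralizing \<open>z\<close> preserves the order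
      and commutes with \<open>a\<close>, so it maps minimal points to minimal points.\<close>
    have "a *v (z *v q) \<preceq> cw ((*v) a) *\<^sub>R (z *v q)" if a: "a \<in> ?A" for a
    proof -
      have "z *v (a *v q) \<preceq> z *v (cw ((*v) a) *\<^sub>R q)" using q a by (intro L_le z(1)) (auto simp: Min_cone_def)
      moreover have "a *v (z *v q) = z *v (a *v q)" using za a by (simp add: matrix_vector_mul_assoc)
      ultimately show ?thesis by (simp add: matrix_vector_mult_scaleR)
    qed
    moreover have "z *v q \<in> D" using L_D[OF z(1)] q by (simp add: Min_cone_def)
    ultimately have "z *v q \<in> ?Mc" by (simp add: Min_cone_def)
    then show "x \<in> ?M" using M_iff[of "z *v q"] McK G(3) z(2) pact_pcls by (metis subsetD)
  qed
  then show ?thesis using M_ne hull by simp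
qed

end
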